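(* Let $K$ be a field of characteristic $\ne2$ and let $N$ be an indecomposable power-associative nil evolution $K$-algebra of dimension $\le 6$ which is not associative and satisfies $\dim(\mathrm{ann}(N))=1$, written in a natural basis $\{e_i\}$ in one of the ten normal forms listed in the context. Then the derivations of $N$ are exactly the linear maps $d$ of the following form, where the scalars $d_{ji}\in K$ that appear are arbitrary, and $\mathfrak{D}(N)$ is, as a vector space, as indicated: (1) $N_{4,6}$: $d(e_1)=d_{11}e_1+d_{41}e_4$, $d(e_2)=d_{22}e_2+(2d_{11}-d_{22})e_3+d_{42}e_4$, $d(e_3)=(2d_{11}-d_{22})e_2+d_{22}e_3-d_{42}e_4$, $d(e_4)=2d_{22}e_4$; $\mathfrak{D}(N)\simeq K^2\times K^2$. (2) $N_{5,10}(\alpha)$: $d(e_1)=d_{11}e_1+d_{51}e_5$, $d(e_2)=d_{22}e_2+(2d_{11}-d_{22})e_3+d_{42}e_4+d_{52}e_5$, $d(e_3)=(2d_{11}-d_{22})e_2+d_{22}e_3-d_{42}e_4-d_{52}e_5$, $d(e_4)=-\alpha d_{42}e_2-\alpha d_{42}e_3+d_{22}e_4+d_{54}e_5$, $d(e_5)=2d_{22}e_5$; $\mathfrak{D}(N)\simeq K^3\times K^3$. (3) $N_{5,11}(\alpha)$: $d(e_1)=d_{11}e_1+d_{41}e_4+d_{51}e_5$, $d(e_2)=d_{22}e_2+(2d_{11}-d_{22})e_3+d_{52}e_5$, $d(e_3)=(2d_{11}-d_{22})e_2+d_{22}e_3-d_{52}e_5$, $d(e_4)=-\alpha d_{41}e_1+d_{11}e_4+d_{54}e_5$,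 $d(e_5)=2d_{22}e_5$; $\mathfrak{D}(N)\simeq K^3\times K^3$. (4) $N_{5,12}(\alpha,\beta)$: $d(e_1)=d_{11}e_1+d_{51}e_5$, $d(e_2)=d_{11}e_2+d_{11}e_3+d_{52}e_5$, $d(e_3)=d_{11}e_2+d_{11}e_3-d_{52}e_5$, $d(e_4)=d_{11}e_4+d_{54}e_5$, $d(e_5)=2d_{11}e_5$; $\mathfrak{D}(N)\simeq K\times K^3$. (5) $N_{6,19}(\alpha,\beta)$: $d(e_1)=d_{11}e_1+d_{61}e_6$, $d(e_2)=d_{22}e_2+(2d_{11}-d_{22})e_3+d_{42}e_4+d_{52}e_5+d_{62}e_6$, $d(e_3)=(2d_{11}-d_{22})e_2+d_{22}e_3-d_{42}e_4-d_{52}e_5-d_{62}e_6$, $d(e_4)=-\alpha d_{42}e_2-\alpha d_{42}e_3+d_{22}e_4+d_{54}e_5+d_{64}e_6$, $d(e_5)=-\beta d_{52}e_2-\beta d_{52}e_3-\alpha^{-1}\beta d_{54}e_4+d_{22}e_5+d_{65}e_6$, $d(e_6)=2d_{22}e_6$; $\mathfrak{D}(N)\simeq K^5\times K^4$. (6) $N_{6,20}(\alpha,\beta)$: $d(e_1)=d_{11}e_1+d_{41}e_4+d_{61}e_6$, $d(e_2)=d_{22}e_2+(2d_{11}-d_{22})e_3+d_{52}e_5+d_{62}e_6$, $d(e_3)=(2d_{11}-d_{22})e_2+d_{22}e_3-d_{52}e_5-d_{62}e_6$, $d(e_4)=-\alpha d_{41}e_1+d_{11}e_4+d_{64}e_6$,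 $d(e_5)=-\beta d_{52}e_2-\beta d_{52}e_3+d_{22}e_5+d_{65}e_6$, $d(e_6)=2d_{22}e_6$; $\mathfrak{D}(N)\simeq K^4\times K^4$. (7) $N_{6,21}(\alpha,\beta,\gamma)$: $d(e_1)=d_{11}e_1+d_{61}e_6$, $d(e_2)=d_{11}e_2+d_{11}e_3+d_{52}e_5+d_{62}e_6$, $d(e_3)=d_{11}e_2+d_{11}e_3-d_{52}e_5-d_{62}e_6$, $d(e_4)=d_{11}e_4+d_{64}e_6$, $d(e_5)=-\gamma d_{52}e_2-\gamma d_{52}e_3+d_{11}e_5+d_{65}e_6$, $d(e_6)=2d_{11}e_6$; $\mathfrak{D}(N)\simeq K^2\times K^4$. (8) $N_{6,22}(\alpha,\beta)$: $d(e_1)=d_{11}e_1+d_{41}e_4+d_{51}e_5+d_{61}e_6$, $d(e_2)=d_{22}e_2+(2d_{11}-d_{22})e_3+d_{62}e_6$, $d(e_3)=(2d_{11}-d_{22})e_2+d_{22}e_3-d_{62}e_6$, $d(e_4)=-\alpha d_{41}e_1+d_{11}e_4+d_{54}e_5+d_{64}e_6$, $d(e_5)=-\beta d_{51}e_1-\alpha^{-1}\beta d_{54}e_4+d_{11}e_5+d_{65}e_6$, $d(e_6)=2d_{22}e_6$; $\mathfrak{D}(N)\simeq K^5\times K^4$. (9) $N_{6,23}(\alpha,\beta,\gamma,\delta)$: $d(e_1)=d_{11}e_1+d_{61}e_6$, $d(e_2)=d_{11}e_2+d_{11}e_3+d_{62}e_6$, $d(e_3)=d_{11}e_2+d_{11}e_3-d_{62}e_6$,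 $d(e_4)=d_{11}e_4+d_{64}e_6$, $d(e_5)=d_{11}e_5+d_{65}e_6$, $d(e_6)=2d_{11}e_6$; $\mathfrak{D}(N)\simeq K\times K^4$. (10) $N_{6,24}(\alpha,\beta,\gamma)$: $d(e_1)=d_{11}e_1+d_{51}e_5+d_{61}e_6$, $d(e_2)=d_{11}e_2+d_{11}e_3+d_{62}e_6$, $d(e_3)=d_{11}e_2+d_{11}e_3-d_{62}e_6$, $d(e_4)=d_{11}e_4+d_{64}e_6$, $d(e_5)=-\gamma d_{51}e_1+d_{11}e_5+d_{65}e_6$, $d(e_6)=2d_{11}e_6$; $\mathfrak{D}(N)\simeq K^2\times K^4$.
   Context: An evolution $K$-algebra is a finite-dimensional commutative (not necessarily associative) $K$-algebra with a basis $\{e_1,\dots,e_n\}$ (a natural basis) such that $e_ie_j=0$ for $i\neq j$. It is power-associative if every subalgebra generated by one element is associative; nil if for every $a$ some power $a^m$ is $0$; indecomposable if it is not a direct sum of two nonzero ideals; $\mathrm{ann}(N)=\{x\in N:xN=0\}$. $\mathfrak{D}(N)$ is the space of derivations, i.e. linear maps $d:N\to N$ with $d(uv)=ud(v)+d(u)v$. Known classification (from earlier work, to be taken as given): every non-associative indecomposable power-associative nil evolution algebra of dimension $n\le6$ with one-dimensional annihilator is isomorphic to one of the following. In all of them $e_ie_j=0$ for $i\ne j$, $e_1^2=e_2+e_3$, $e_2^2=e_n$, $e_3^2=-e_n$, $e_n^2=0$, where $n=\dim N$, and the remaining squares are: - $N_{4,6}$ ($n=4$): none. - $N_{5,10}(\alpha)$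 ($n=5$): $e_4^2=\alpha e_5$, $\alpha\in K^*$. - $N_{5,11}(\alpha)$: $e_4^2=\alpha(e_2+e_3)$, $\alpha\in K^*$. - $N_{5,12}(\alpha,\beta)$: $e_4^2=\alpha(e_2+e_3)+\beta e_5$, $\alpha,\beta\in K^*$. - $N_{6,19}(\alpha,\beta)$ ($n=6$): $e_4^2=\alpha e_6$, $e_5^2=\beta e_6$, $\alpha,\beta\in K^*$. - $N_{6,20}(\alpha,\beta)$: $e_4^2=\alpha(e_2+e_3)$, $e_5^2=\beta e_6$, $\alpha,\beta\in K^*$. - $N_{6,21}(\alpha,\beta,\gamma)$: $e_4^2=\alpha(e_2+e_3)+\beta e_6$, $e_5^2=\gamma e_6$, $\alpha,\beta,\gamma\in K^*$. - $N_{6,22}(\alpha,\beta)$: $e_4^2=\alpha(e_2+e_3)$, $e_5^2=\beta(e_2+e_3)$, $\alpha,\beta\in K^*$. - $N_{6,23}(\alpha,\beta,\gamma,\delta)$: $e_4^2=\alpha(e_2+e_3)+\beta e_6$, $e_5^2=\gamma(e_2+e_3)+\delta e_6$, with $\alpha\delta-\beta\gamma\ne0$, $\alpha\gamma\neq0$, $\beta\delta\ne0$. - $N_{6,24}(\alpha,\beta,\gamma)$: $e_4^2=\alpha(e_2+e_3)+\beta e_6$, $e_5^2=\gamma(e_2+e_3)$, with $\alpha\beta\gamma\neq0$. *)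

theory Defs
  imports "HOL-Analysis.Analysis" "HOL-Library.Function_Algebras"
begin

text \<open>
  A \<open>K\<close>-algebra is a type \<open>'v\<close> with a \<open>K\<close>-vector space structure \<open>smul\<close> and a bilinear
  multiplication \<open>mul\<close>; neither associativity nor a unit is required.
\<close>

definition nonassoc_algebra :: "('k::field \<Rightarrow> 'v::ab_group_add \<Rightarrow> 'v) \<Rightarrow> ('v \<Rightarrow> 'v \<Rightarrow> 'v) \<Rightarrow> bool" where
  "nonassoc_algebra smul mul \<longleftrightarrow> vector_space smul \<and>
     (\<forall>x. Vector_Spaces.linear smul smul (\<lambda>y. mul x y)) \<and>
     (\<forall>y. Vector_Spaces.linear smul smul (\<lambda>x. mul x y))"

definition natural_basis ::
  "('k::field \<Rightarrow> 'v::ab_group_add \<Rightarrow> 'v) \<Rightarrow> ('v \<Rightarrow> 'v \<Rightarrow> 'v) \<Rightarrow> nat \<Rightarrow> (nat \<Rightarrow> 'v) \<Rightarrow> bool" where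
  "natural_basis smul mul n e \<longleftrightarrow>
     inj_on e {1..n} \<and> \<not> module.dependent smul (e ` {1..n}) \<and>
     module.span smul (e ` {1..n}) = UNIV \<and>
     (\<forall>i\<in>{1..n}. \<forall>j\<in>{1..n}. i \<noteq> j \<longrightarrow> mul (e i) (e j) = 0)"

definition evolution_algebra ::
  "('k::field \<Rightarrow> 'v::ab_group_add \<Rightarrow> 'v) \<Rightarrow> ('v \<Rightarrow> 'v \<Rightarrow> 'v) \<Rightarrow> bool" where
  "evolution_algebra smul mul \<longleftrightarrow> nonassoc_algebra smul mul \<and>
     (\<forall>x y. mul x y = mul y x) \<and> (\<exists>n e. natural_basis smul mul n e)"

definition associative_on :: "('v \<Rightarrow> 'v \<Rightarrow> 'v) \<Rightarrow> 'v set \<Rightarrow> bool" where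
  "associative_on mul S \<longleftrightarrow> (\<forall>x\<in>S. \<forall>y\<in>S. \<forall>z\<in>S. mul (mul x y) z = mul x (mul y z))"

definition subalgebra ::
  "('k::field \<Rightarrow> 'v::ab_group_add \<Rightarrow> 'v) \<Rightarrow> ('v \<Rightarrow> 'v \<Rightarrow> 'v) \<Rightarrow> 'v set \<Rightarrow> bool" where
  "subalgebra smul mul S \<longleftrightarrow> module.subspace smul S \<and> (\<forall>x\<in>S. \<forall>y\<in>S. mul x y \<in> S)"

definition power_associative ::
  "('k::field \<Rightarrow> 'v::ab_group_add \<Rightarrow> 'v) \<Rightarrow> ('v \<Rightarrow> 'v \<Rightarrow> 'v) \<Rightarrow> bool" where
  "power_associative smul mul \<longleftrightarrow>
     (\<forall>a. associative_on mul (subalgebra smul mul hull {a}))"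

text \<open>There is no unit, so powers start at exponent 1: \<open>alg_power mul a m\<close> is the power with
  exponent \<open>m + 1\<close>.\<close>

primrec alg_power :: "('v \<Rightarrow> 'v \<Rightarrow> 'v) \<Rightarrow> 'v \<Rightarrow> nat \<Rightarrow> 'v" where
  "alg_power mul a 0 = a"
| "alg_power mul a (Suc m) = mul (alg_power mul a m) a"

definition nil_algebra :: "('v::ab_group_add \<Rightarrow> 'v \<Rightarrow> 'v) \<Rightarrow> bool" where
  "nil_algebra mul \<longleftrightarrow> (\<forall>a. \<exists>m. alg_power mul a m = 0)"

definition algebra_ideal ::
  "('k::field \<Rightarrow> 'v::ab_group_add \<Rightarrow> 'v) \<Rightarrow> ('v \<Rightarrow> 'v \<Rightarrow> 'v) \<Rightarrow> 'v set \<Rightarrow> bool" where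
  "algebra_ideal smul mul I \<longleftrightarrow>
     module.subspace smul I \<and> (\<forall>x\<in>I. \<forall>y. mul x y \<in> I \<and> mul y x \<in> I)"

definition indecomposable ::
  "('k::field \<Rightarrow> 'v::ab_group_add \<Rightarrow> 'v) \<Rightarrow> ('v \<Rightarrow> 'v \<Rightarrow> 'v) \<Rightarrow> bool" where
  "indecomposable smul mul \<longleftrightarrow>
     \<not> (\<exists>I J. algebra_ideal smul mul I \<and> algebra_ideal smul mul J \<and> I \<noteq> {0} \<and> J \<noteq> {0} \<and>
              I \<inter> J = {0} \<and> {x + y | x y. x \<in> I \<and> y \<in> J} = UNIV)"

definition annihilator :: "('v::ab_group_add \<Rightarrow> 'v \<Rightarrow> 'v) \<Rightarrow> 'v set" where
  "annihilator mul = {x. \<forall>y. mul x y = 0}"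

definition derivations ::
  "('k::field \<Rightarrow> 'v::ab_group_add \<Rightarrow> 'v) \<Rightarrow> ('v \<Rightarrow> 'v \<Rightarrow> 'v) \<Rightarrow> ('v \<Rightarrow> 'v) set" where
  "derivations smul mul =
     {d. Vector_Spaces.linear smul smul d \<and>
         (\<forall>u v. d (mul u v) = mul u (d v) + mul (d u) v)}"

text \<open>The space of all maps \<open>'v \<Rightarrow> 'v\<close> carries the pointwise vector space structure (its addition
  is the one of \<^theory>\<open>HOL-Library.Function_Algebras\<close>). A subset \<open>W\<close> of a vector space is
  isomorphic to a vector space if it is the bijective image of a linear map, which makes it a
  subspace in particular.\<close>

definition fun_scale :: "('k \<Rightarrow> 'v \<Rightarrow> 'v) \<Rightarrow> 'k \<Rightarrow> ('a \<Rightarrow> 'v) \<Rightarrow> 'a \<Rightarrow> 'v" where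
  "fun_scale smul c f = (\<lambda>x. smul c (f x))"

definition vector_space_iso_onto ::
  "('k::field \<Rightarrow> 'b::ab_group_add \<Rightarrow> 'b) \<Rightarrow> ('k \<Rightarrow> 'c::ab_group_add \<Rightarrow> 'c) \<Rightarrow> ('b \<Rightarrow> 'c) \<Rightarrow> 'c set \<Rightarrow> bool"
  where
  "vector_space_iso_onto s1 s2 \<phi> W \<longleftrightarrow> Vector_Spaces.linear s1 s2 \<phi> \<and> bij_betw \<phi> UNIV W"

context
  fixes smul :: "'k::field \<Rightarrow> 'v::ab_group_add \<Rightarrow> 'v" (infixr \<open>\<cdot>\<close> 75)
    and mul :: "'v \<Rightarrow> 'v \<Rightarrow> 'v" (infixl \<open>\<odot>\<close> 70)
begin

text \<open>The part of the multiplication table that all normal forms of dimension \<open>n\<close> share.\<close>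

definition common_form :: "nat \<Rightarrow> (nat \<Rightarrow> 'v) \<Rightarrow> bool" where
  "common_form n e \<longleftrightarrow> natural_basis smul mul n e \<and>
     e 1 \<odot> e 1 = e 2 + e 3 \<and> e 2 \<odot> e 2 = e n \<and> e 3 \<odot> e 3 = - e n \<and> e n \<odot> e n = 0"

definition N4_6 :: "(nat \<Rightarrow> 'v) \<Rightarrow> bool" where
  "N4_6 e \<longleftrightarrow> common_form 4 e"

definition N5_10 :: "'k \<Rightarrow> (nat \<Rightarrow> 'v) \<Rightarrow> bool" where
  "N5_10 \<alpha> e \<longleftrightarrow> common_form 5 e \<and> \<alpha> \<noteq> 0 \<and> e 4 \<odot> e 4 = \<alpha> \<cdot> e 5"

definition N5_11 :: "'k \<Rightarrow> (nat \<Rightarrow> 'v) \<Rightarrow> bool" where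
  "N5_11 \<alpha> e \<longleftrightarrow> common_form 5 e \<and> \<alpha> \<noteq> 0 \<and> e 4 \<odot> e 4 = \<alpha> \<cdot> (e 2 + e 3)"

definition N5_12 :: "'k \<Rightarrow> 'k \<Rightarrow> (nat \<Rightarrow> 'v) \<Rightarrow> bool" where
  "N5_12 \<alpha> \<beta> e \<longleftrightarrow> common_form 5 e \<and> \<alpha> \<noteq> 0 \<and> \<beta> \<noteq> 0 \<and>
     e 4 \<odot> e 4 = \<alpha> \<cdot> (e 2 + e 3) + \<beta> \<cdot> e 5"

definition N6_19 :: "'k \<Rightarrow> 'k \<Rightarrow> (nat \<Rightarrow> 'v) \<Rightarrow> bool" where
  "N6_19 \<alpha> \<beta> e \<longleftrightarrow> common_form 6 e \<and> \<alpha> \<noteq> 0 \<and> \<beta> \<noteq> 0 \<and>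
     e 4 \<odot> e 4 = \<alpha> \<cdot> e 6 \<and> e 5 \<odot> e 5 = \<beta> \<cdot> e 6"

definition N6_20 :: "'k \<Rightarrow> 'k \<Rightarrow> (nat \<Rightarrow> 'v) \<Rightarrow> bool" where
  "N6_20 \<alpha> \<beta> e \<longleftrightarrow> common_form 6 e \<and> \<alpha> \<noteq> 0 \<and> \<beta> \<noteq> 0 \<and>
     e 4 \<odot> e 4 = \<alpha> \<cdot> (e 2 + e 3) \<and> e 5 \<odot> e 5 = \<beta> \<cdot> e 6"

definition N6_21 :: "'k \<Rightarrow> 'k \<Rightarrow> 'k \<Rightarrow> (nat \<Rightarrow> 'v) \<Rightarrow> bool" where
  "N6_21 \<alpha> \<beta> \<gamma> e \<longleftrightarrow> common_form 6 e \<and> \<alpha> \<noteq> 0 \<and> \<beta> \<noteq> 0 \<and> \<gamma> \<noteq> 0 \<and>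
     e 4 \<odot> e 4 = \<alpha> \<cdot> (e 2 + e 3) + \<beta> \<cdot> e 6 \<and> e 5 \<odot> e 5 = \<gamma> \<cdot> e 6"

definition N6_22 :: "'k \<Rightarrow> 'k \<Rightarrow> (nat \<Rightarrow> 'v) \<Rightarrow> bool" where
  "N6_22 \<alpha> \<beta> e \<longleftrightarrow> common_form 6 e \<and> \<alpha> \<noteq> 0 \<and> \<beta> \<noteq> 0 \<and>
     e 4 \<odot> e 4 = \<alpha> \<cdot> (e 2 + e 3) \<and> e 5 \<odot> e 5 = \<beta> \<cdot> (e 2 + e 3)"

definition N6_23 :: "'k \<Rightarrow> 'k \<Rightarrow> 'k \<Rightarrow> 'k \<Rightarrow> (nat \<Rightarrow> 'v) \<Rightarrow> bool" where
  "N6_23 \<alpha> \<beta> \<gamma> \<delta> e \<longleftrightarrow> common_form 6 e \<and>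
     \<alpha> * \<delta> - \<beta> * \<gamma> \<noteq> 0 \<and> \<alpha> * \<gamma> \<noteq> 0 \<and> \<beta> * \<delta> \<noteq> 0 \<and>
     e 4 \<odot> e 4 = \<alpha> \<cdot> (e 2 + e 3) + \<beta> \<cdot> e 6 \<and> e 5 \<odot> e 5 = \<gamma> \<cdot> (e 2 + e 3) + \<delta> \<cdot> e 6"

definition N6_24 :: "'k \<Rightarrow> 'k \<Rightarrow> 'k \<Rightarrow> (nat \<Rightarrow> 'v) \<Rightarrow> bool" where
  "N6_24 \<alpha> \<beta> \<gamma> e \<longleftrightarrow> common_form 6 e \<and> \<alpha> * \<beta> * \<gamma> \<noteq> 0 \<and>
     e 4 \<odot> e 4 = \<alpha> \<cdot> (e 2 + e 3) + \<beta> \<cdot> e 6 \<and> e 5 \<odot> e 5 = \<gamma> \<cdot> (e 2 + e 3)"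

end

end

theory Submission
  imports Defs
begin

text \<open>
  Write \<open>a i j\<close> for the coefficient of \<open>e i\<close> in \<open>d (e j)\<close>. Since distinct basis vectors multiply to
  zero, the Leibniz rule for a linear map \<open>d\<close> only has to be tested on the squares and on the pairs
  \<open>i \<noteq> j\<close>, where it says \<open>d (e i \<odot> e i) = 2 a i i (e i \<odot> e i)\<close> and
  \<open>a i j (e i \<odot> e i) + a j i (e j \<odot> e j) = 0\<close> (\<open>derivation_iff_matrix\<close>).

  In all ten algebras every square lies in the plane spanned by \<open>f = e 2 + e 3\<close> and \<open>e n\<close>, say
  \<open>e i \<odot> e i = p i f + q i e n\<close>. As \<open>f\<close> is the square of \<open>e 1\<close> and \<open>e n\<close> that of \<open>e 2\<close>, a derivation has
  both as eigenvectors, with eigenvalues \<open>2 a 1 1\<close> and \<open>2 a 2 2\<close>. Comparing coefficients in this plane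
  and cancelling the 2, the whole condition becomes a system of scalar equations in the \<open>a i j\<close>
  (\<open>derivation_iff\<close>, \<open>derivation_iff_scalar\<close>): \<open>p i \<noteq> 0\<close> forces \<open>a i i = a 1 1\<close>, \<open>q i \<noteq> 0\<close> forces
  \<open>a i i = a 2 2\<close>, two basis vectors with linearly independent squares do not occur in each other's
  image, and two with proportional nonzero squares share a single parameter. The vector \<open>e n\<close> has
  square zero, so its coefficient in the image of any other basis vector other than \<open>e 3\<close> is free;
  the column of \<open>e 3\<close> is determined by that of \<open>e 2\<close> because \<open>d f\<close> is a multiple of \<open>f\<close>.
  Putting in the values of \<open>p\<close> and \<open>q\<close> for the normal forms gives the ten matrix shapes.

  For the dimensions, each shape is a linear function of its parameters that vanishes only at the
  parameter 0, and a linear map is determined freely by its values on the basis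
  (\<open>iso_onto_linear_family\<close>).
\<close>

section \<open>Derivations in a natural basis\<close>

(* Basis indices start at 1, and the entries for e 1 should look like those for e 2, e 3, ... *)
declare One_nat_def [simp del]

lemma two_neq_zero:
  assumes "CHAR('k::field) \<noteq> 2"
  shows "(2 :: 'k) \<noteq> 0"
proof
  assume "(2 :: 'k) = 0"
  then have "CHAR('k) dvd 2"
    using of_nat_eq_0_iff_char_dvd[where 'a='k, of 2] by simp
  then have "CHAR('k) = 1 \<or> CHAR('k) = 2"
    by (cases "CHAR('k) = 0") (auto dest!: dvd_imp_le)
  then show False using assms CHAR_not_1[where 'a='k] by auto
qed

locale evolution_basis = vector_space smul
  for smul :: "'k::field \<Rightarrow> 'v::ab_group_add \<Rightarrow> 'v" (infixr \<open>\<cdot>\<close> 75) +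
  fixes mul :: "'v \<Rightarrow> 'v \<Rightarrow> 'v" (infixl \<open>\<odot>\<close> 70)
    and n :: nat and e :: "nat \<Rightarrow> 'v"
  assumes linear_right: "Vector_Spaces.linear smul smul (\<lambda>y. x \<odot> y)"
    and linear_left: "Vector_Spaces.linear smul smul (\<lambda>x. x \<odot> y)"
    and basis: "natural_basis smul mul n e"
begin

sublocale right: Vector_Spaces.linear smul smul "\<lambda>y. x \<odot> y" for x
  by (rule linear_right)

sublocale left: Vector_Spaces.linear smul smul "\<lambda>x. x \<odot> y" for y
  by (rule linear_left)

lemma inj_basis: "inj_on e {1..n}"
  and independent_basis: "independent (e ` {1..n})"
  and span_basis: "span (e ` {1..n}) = UNIV"
  and mul_basis: "\<lbrakk>i \<in> {1..n}; j \<in> {1..n}; i \<noteq> j\<rbrakk> \<Longrightarrow> e i \<odot> e j = 0"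
  using basis by (auto simp: natural_basis_def)

definition coord :: "nat \<Rightarrow> 'v \<Rightarrow> 'k" where
  "coord i v = representation (e ` {1..n}) v (e i)"

lemma linear_coord: "Vector_Spaces.linear smul (*) (coord i)"
  unfolding coord_def by (rule linear_representation[OF independent_basis span_basis])

sublocale coord: Vector_Spaces.linear smul "(*)" "coord i" for i
  by (rule linear_coord)

lemma coord_basis: "\<lbrakk>i \<in> {1..n}; j \<in> {1..n}\<rbrakk> \<Longrightarrow> coord i (e j) = (if i = j then 1 else 0)"
  using inj_basis by (auto simp: coord_def representation_basis independent_basis inj_on_eq_iff)

lemma sum_coord: "(\<Sum>i\<in>{1..n}. coord i v \<cdot> e i) = v"
  using sum_representation_eq[of "e ` {1..n}" v "e ` {1..n}"] inj_basis
  by (simp add: coord_def independent_basis span_basis sum.reindex)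

lemma eq_iff_coord: "v = w \<longleftrightarrow> (\<forall>i\<in>{1..n}. coord i v = coord i w)"
proof
  assume "\<forall>i\<in>{1..n}. coord i v = coord i w"
  then have "(\<Sum>i\<in>{1..n}. coord i v \<cdot> e i) = (\<Sum>i\<in>{1..n}. coord i w \<cdot> e i)"
    by (intro sum.cong) auto
  then show "v = w" by (simp only: sum_coord)
qed simp

lemma linear_eq_on_basis:
  assumes "Vector_Spaces.linear smul smul f" "Vector_Spaces.linear smul smul g"
    and "\<forall>i\<in>{1..n}. f (e i) = g (e i)"
  shows "f v = g v"
proof -
  interpret vector_space_pair smul smul by unfold_locales
  show ?thesis
    using assms by (intro linear_eq_on[of f g v "e ` {1..n}"]) (auto simp: span_basis)
qed

lemma mul_basis_left:
  assumes "i \<in> {1..n}"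
  shows "e i \<odot> v = coord i v \<cdot> (e i \<odot> e i)"
proof -
  have "e i \<odot> v = (\<Sum>j\<in>{1..n}. coord j v \<cdot> (e i \<odot> e j))"
    by (subst sum_coord[of v, symmetric]) (simp add: right.sum right.scale)
  also have "\<dots> = (\<Sum>j\<in>{1..n}. if j = i then coord i v \<cdot> (e i \<odot> e i) else 0)"
    using assms by (intro sum.cong) (auto simp: mul_basis)
  also have "\<dots> = coord i v \<cdot> (e i \<odot> e i)"
    using assms by simp
  finally show ?thesis .
qed

lemma mul_basis_right:
  assumes "i \<in> {1..n}"
  shows "v \<odot> e i = coord i v \<cdot> (e i \<odot> e i)"
proof -
  have "v \<odot> e i = (\<Sum>j\<in>{1..n}. coord j v \<cdot> (e j \<odot> e i))"
    by (subst sum_coord[of v, symmetric]) (simp add: left.sum left.scale)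
  also have "\<dots> = (\<Sum>j\<in>{1..n}. if j = i then coord i v \<cdot> (e i \<odot> e i) else 0)"
    using assms by (intro sum.cong) (auto simp: mul_basis)
  also have "\<dots> = coord i v \<cdot> (e i \<odot> e i)"
    using assms by simp
  finally show ?thesis .
qed

text \<open>Both sides of the Leibniz rule are bilinear, so it may be tested on pairs of basis vectors.\<close>

lemma derivation_iff_on_basis:
  assumes d: "Vector_Spaces.linear smul smul d"
  shows "d \<in> derivations smul mul \<longleftrightarrow>
    (\<forall>i\<in>{1..n}. \<forall>j\<in>{1..n}. d (e i \<odot> e j) = e i \<odot> d (e j) + d (e i) \<odot> e j)"
    (is "_ \<longleftrightarrow> ?R")
proof
  assume ?R
  interpret d: Vector_Spaces.linear smul smul d by (rule d)
  interpret vector_space_pair smul smul by unfold_locales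
  note lin = Vector_Spaces.linear_compose[OF linear_right d, unfolded o_def]
    Vector_Spaces.linear_compose[OF linear_left d, unfolded o_def]
    Vector_Spaces.linear_compose[OF d linear_right, unfolded o_def]
    Vector_Spaces.linear_compose[OF d linear_left, unfolded o_def]
  have 1: "d (e i \<odot> v) = e i \<odot> d v + d (e i) \<odot> v" if "i \<in> {1..n}" for i v
    using \<open>?R\<close> that
    by (intro linear_eq_on_basis[of "\<lambda>v. d (e i \<odot> v)"] linear_compose_add lin linear_right) auto
  have "d (u \<odot> v) = u \<odot> d v + d u \<odot> v" for u v
    by (intro linear_eq_on_basis[of "\<lambda>u. d (u \<odot> v)"] linear_compose_add lin linear_left)
      (auto simp: 1)
  then show "d \<in> derivations smul mul" by (simp add: derivations_def d)
qed (simp add: derivations_def)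

lemma derivation_iff_matrix:
  assumes d: "Vector_Spaces.linear smul smul d"
  shows "d \<in> derivations smul mul \<longleftrightarrow>
    (\<forall>i\<in>{1..n}. \<forall>j\<in>{1..n}. i \<noteq> j \<longrightarrow>
       coord i (d (e j)) \<cdot> (e i \<odot> e i) + coord j (d (e i)) \<cdot> (e j \<odot> e j) = 0) \<and>
    (\<forall>i\<in>{1..n}. d (e i \<odot> e i) = (2 * coord i (d (e i))) \<cdot> (e i \<odot> e i))"
proof -
  interpret d: Vector_Spaces.linear smul smul d by (rule d)
  have diag: "e i \<odot> d (e i) + d (e i) \<odot> e i = (2 * coord i (d (e i))) \<cdot> (e i \<odot> e i)"
    if "i \<in> {1..n}" for i
    unfolding mul_basis_left[OF that, of "d (e i)"] mul_basis_right[OF that, of "d (e i)"]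
    by (simp only: mult_2 scale_left_distrib)
  have off: "e i \<odot> d (e j) + d (e i) \<odot> e j =
      coord i (d (e j)) \<cdot> (e i \<odot> e i) + coord j (d (e i)) \<cdot> (e j \<odot> e j)"
    if "i \<in> {1..n}" "j \<in> {1..n}" for i j
    by (simp only: mul_basis_left[OF that(1), of "d (e j)"] mul_basis_right[OF that(2), of "d (e i)"])
  have zero: "d (e i \<odot> e j) = 0" if "i \<in> {1..n}" "j \<in> {1..n}" "i \<noteq> j" for i j
    by (simp only: mul_basis[OF that] d.zero)
  show ?thesis
    unfolding derivation_iff_on_basis[OF d]
  proof (intro iffI conjI ballI impI)
    fix i j
    assume *: "\<forall>i\<in>{1..n}. \<forall>j\<in>{1..n}. d (e i \<odot> e j) = e i \<odot> d (e j) + d (e i) \<odot> e j"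
      and ij: "i \<in> {1..n}" "j \<in> {1..n}" "i \<noteq> j"
    show "coord i (d (e j)) \<cdot> (e i \<odot> e i) + coord j (d (e i)) \<cdot> (e j \<odot> e j) = 0"
      using *[rule_format, OF ij(1,2)] unfolding zero[OF ij] off[OF ij(1,2)] by (rule sym)
  next
    fix i
    assume *: "\<forall>i\<in>{1..n}. \<forall>j\<in>{1..n}. d (e i \<odot> e j) = e i \<odot> d (e j) + d (e i) \<odot> e j"
      and i: "i \<in> {1..n}"
    show "d (e i \<odot> e i) = (2 * coord i (d (e i))) \<cdot> (e i \<odot> e i)"
      using *[rule_format, OF i i] unfolding diag[OF i] .
  next
    fix i j
    assume *: "(\<forall>i\<in>{1..n}. \<forall>j\<in>{1..n}. i \<noteq> j \<longrightarrow>
         coord i (d (e j)) \<cdot> (e i \<odot> e i) + coord j (d (e i)) \<cdot> (e j \<odot> e j) = 0) \<and>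
       (\<forall>i\<in>{1..n}. d (e i \<odot> e i) = (2 * coord i (d (e i))) \<cdot> (e i \<odot> e i))"
      and ij: "i \<in> {1..n}" "j \<in> {1..n}"
    show "d (e i \<odot> e j) = e i \<odot> d (e j) + d (e i) \<odot> e j"
    proof (cases "i = j")
      case True
      then show ?thesis using * ij diag by simp
    next
      case False
      then show ?thesis using * ij unfolding off[OF ij] zero[OF ij False] by simp
    qed
  qed
qed

text \<open>
  A family of linear maps whose columns \<open>C x 1, \<dots>, C x n\<close> depend linearly on a parameter \<open>x\<close>, with
  trivial kernel, is isomorphic to the parameter space: linear maps with prescribed columns exist
  and are unique.
\<close>

lemma iso_onto_linear_family:
  fixes scaleP :: "'k \<Rightarrow> 'p::ab_group_add \<Rightarrow> 'p" and C :: "'p \<Rightarrow> nat \<Rightarrow> 'v"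
  assumes C: "\<And>j. j \<in> {1..n} \<Longrightarrow> Vector_Spaces.linear scaleP smul (\<lambda>x. C x j)"
    and inj: "\<And>x. \<forall>j\<in>{1..n}. C x j = 0 \<Longrightarrow> x = 0"
    and P: "vector_space scaleP"
    and D: "D = {d. Vector_Spaces.linear smul smul d \<and> (\<exists>x. \<forall>j\<in>{1..n}. d (e j) = C x j)}"
  shows "\<exists>\<phi>. vector_space_iso_onto scaleP (fun_scale smul) \<phi> D"
proof -
  define \<phi> where "\<phi> x v = (\<Sum>j\<in>{1..n}. coord j v \<cdot> C x j)" for x v
  have C_add: "C (x + y) j = C x j + C y j" and C_scale: "C (scaleP c x) j = c \<cdot> C x j"
    and C_diff: "C (x - y) j = C x j - C y j"
    if "j \<in> {1..n}" for x y c j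
  proof -
    interpret C: Vector_Spaces.linear scaleP smul "\<lambda>x. C x j" by (rule C[OF that])
    show "C (x + y) j = C x j + C y j" "C (scaleP c x) j = c \<cdot> C x j" "C (x - y) j = C x j - C y j"
      by (rule C.add C.scale C.diff)+
  qed
  have F: "vector_space (fun_scale smul :: 'k \<Rightarrow> ('v \<Rightarrow> 'v) \<Rightarrow> 'v \<Rightarrow> 'v)"
    by unfold_locales (auto simp: fun_scale_def fun_eq_iff algebra_simps)
  have lin: "Vector_Spaces.linear smul smul (\<phi> x)" for x
    unfolding Vector_Spaces.linear_iff \<phi>_def
    using vector_space_axioms
    by (simp add: coord.add coord.scale scale_left_distrib sum.distrib scale_sum_right)
  have on_basis: "\<phi> x (e i) = C x i" if "i \<in> {1..n}" for x i
  proof -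
    have "\<phi> x (e i) = (\<Sum>j\<in>{1..n}. if j = i then C x i else 0)"
      unfolding \<phi>_def using that by (intro sum.cong) (auto simp: coord_basis)
    then show ?thesis using that by simp
  qed
  have "Vector_Spaces.linear scaleP (fun_scale smul) \<phi>"
    unfolding Vector_Spaces.linear_iff \<phi>_def
    using P F
    by (auto simp: C_add C_scale scale_right_distrib sum.distrib scale_sum_right fun_scale_def
        fun_eq_iff mult.commute)
  moreover have "inj \<phi>"
  proof (rule injI)
    fix x y assume eq: "\<phi> x = \<phi> y"
    have "\<forall>j\<in>{1..n}. C (x - y) j = 0"
      using C_diff on_basis[of _ x] on_basis[of _ y] by (simp add: eq)
    then show "x = y" using inj[of "x - y"] by simp
  qed
  moreover have "range \<phi> = D"
  proof (intro equalityI subsetI)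
    fix d assume "d \<in> D"
    then obtain x where d: "Vector_Spaces.linear smul smul d" and x: "\<forall>j\<in>{1..n}. d (e j) = C x j"
      by (auto simp: D)
    have "d v = \<phi> x v" for v
      using x by (intro linear_eq_on_basis d lin) (simp add: on_basis)
    then show "d \<in> range \<phi>" by blast
  qed (auto simp: D lin on_basis)
  ultimately show ?thesis
    by (auto simp: vector_space_iso_onto_def bij_betw_def)
qed

end


section \<open>Algebras whose squares lie in a plane\<close>

text \<open>
  The coefficients \<open>p\<close> and \<open>q\<close> express the squares through \<open>e 2 + e 3\<close> and \<open>e n\<close>. The condition
  \<open>q 3 \<noteq> 0\<close> makes \<open>e 2\<close> and \<open>e 3\<close> have the same diagonal entry.
\<close>

locale plane_squares = evolution_basis smul mul n e
  for smul :: "'k::field \<Rightarrow> 'v::ab_group_add \<Rightarrow> 'v" (infixr \<open>\<cdot>\<close> 75)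
    and mul :: "'v \<Rightarrow> 'v \<Rightarrow> 'v" (infixl \<open>\<odot>\<close> 70)
    and n :: nat and e :: "nat \<Rightarrow> 'v" +
  fixes p q :: "nat \<Rightarrow> 'k"
  assumes char_neq_2: "CHAR('k) \<noteq> 2"
    and dim_ge_4: "4 \<le> n"
    and squares: "i \<in> {1..n} \<Longrightarrow> e i \<odot> e i = p i \<cdot> (e 2 + e 3) + q i \<cdot> e n"
    and square_coeffs: "p 1 = 1" "q 1 = 0" "p 2 = 0" "q 2 = 1" "q 3 \<noteq> 0" "p n = 0" "q n = 0"
begin

lemma plane_eq_iff:
  "x \<cdot> (e 2 + e 3) + y \<cdot> e n = x' \<cdot> (e 2 + e 3) + y' \<cdot> e n \<longleftrightarrow> x = x' \<and> y = y'"
  (is "?v = ?w \<longleftrightarrow> _")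
proof
  assume "?v = ?w"
  then have "coord 2 ?v = coord 2 ?w" "coord n ?v = coord n ?w" by simp_all
  then show "x = x' \<and> y = y'"
    using dim_ge_4 by (simp add: coord.add coord.scale coord_basis)
qed simp

text \<open>
  The second and third conditions are the Leibniz rule for the squares of \<open>e 1\<close> and \<open>e 2\<close>. Given these,
  the rule for any other square compares \<open>2 * a 1 1 * p i\<close> with \<open>2 * a i i * p i\<close>, and likewise for
  \<open>q\<close>, which is where the characteristic enters.
\<close>

lemma derivation_iff:
  assumes d: "Vector_Spaces.linear smul smul d"
  shows "d \<in> derivations smul mul \<longleftrightarrow>
    (\<forall>i\<in>{1..n}. \<forall>j\<in>{1..n}. i < j \<longrightarrow>
       coord i (d (e j)) * p i + coord j (d (e i)) * p j = 0 \<and>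
       coord i (d (e j)) * q i + coord j (d (e i)) * q j = 0) \<and>
    d (e 2 + e 3) = (2 * coord 1 (d (e 1))) \<cdot> (e 2 + e 3) \<and>
    d (e n) = (2 * coord 2 (d (e 2))) \<cdot> e n \<and>
    (\<forall>i\<in>{1..n}. (p i \<noteq> 0 \<longrightarrow> coord i (d (e i)) = coord 1 (d (e 1))) \<and>
                (q i \<noteq> 0 \<longrightarrow> coord i (d (e i)) = coord 2 (d (e 2))))"
proof -
  interpret d: Vector_Spaces.linear smul smul d by (rule d)
  let ?a = "\<lambda>i. coord i (d (e i))"
  let ?b = "\<lambda>i j. coord i (d (e j)) \<cdot> (e i \<odot> e i)"
  have off: "coord i (d (e j)) \<cdot> (e i \<odot> e i) + coord j (d (e i)) \<cdot> (e j \<odot> e j) = 0 \<longleftrightarrow>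
      coord i (d (e j)) * p i + coord j (d (e i)) * p j = 0 \<and>
      coord i (d (e j)) * q i + coord j (d (e i)) * q j = 0"
    if "i \<in> {1..n}" "j \<in> {1..n}" for i j
  proof -
    have "coord i (d (e j)) \<cdot> (e i \<odot> e i) + coord j (d (e i)) \<cdot> (e j \<odot> e j) =
      (coord i (d (e j)) * p i + coord j (d (e i)) * p j) \<cdot> (e 2 + e 3) +
      (coord i (d (e j)) * q i + coord j (d (e i)) * q j) \<cdot> e n"
      unfolding squares[OF that(1)] squares[OF that(2)]
      by (simp only: scale_left_distrib scale_right_distrib scale_scale ac_simps)
    then show ?thesis
      using plane_eq_iff[of _ _ 0 0] by simp
  qed
  have diag: "(\<forall>i\<in>{1..n}. d (e i \<odot> e i) = (2 * ?a i) \<cdot> (e i \<odot> e i)) \<longleftrightarrow>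
      d (e 2 + e 3) = (2 * ?a 1) \<cdot> (e 2 + e 3) \<and> d (e n) = (2 * ?a 2) \<cdot> e n \<and>
      (\<forall>i\<in>{1..n}. (p i \<noteq> 0 \<longrightarrow> ?a i = ?a 1) \<and> (q i \<noteq> 0 \<longrightarrow> ?a i = ?a 2))"
    (is "?L \<longleftrightarrow> ?f \<and> ?n \<and> ?R")
  proof -
    have f: ?f and n: ?n if ?L
      using bspec[OF that, of 1] bspec[OF that, of 2] squares[of 1] squares[of 2] dim_ge_4
        square_coeffs
      by simp_all
    have "(d (e i \<odot> e i) = (2 * ?a i) \<cdot> (e i \<odot> e i)) \<longleftrightarrow>
        (p i \<noteq> 0 \<longrightarrow> ?a i = ?a 1) \<and> (q i \<noteq> 0 \<longrightarrow> ?a i = ?a 2)"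
      if ?f ?n "i \<in> {1..n}" for i
    proof -
      have "d (e i \<odot> e i) = (2 * ?a 1 * p i) \<cdot> (e 2 + e 3) + (2 * ?a 2 * q i) \<cdot> e n"
        unfolding squares[OF that(3)] d.add[of "_ \<cdot> _" "_ \<cdot> _"] d.scale that(1,2)
        by (simp only: scale_scale ac_simps)
      moreover have "(2 * ?a i) \<cdot> (e i \<odot> e i) =
          (2 * ?a i * p i) \<cdot> (e 2 + e 3) + (2 * ?a i * q i) \<cdot> e n"
        unfolding squares[OF that(3)] by (simp only: scale_right_distrib scale_scale ac_simps)
      ultimately have "(d (e i \<odot> e i) = (2 * ?a i) \<cdot> (e i \<odot> e i)) \<longleftrightarrow>
          2 * (?a 1 * p i) = 2 * (?a i * p i) \<and> 2 * (?a 2 * q i) = 2 * (?a i * q i)"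
        by (simp only: plane_eq_iff mult.assoc)
      then show ?thesis
        unfolding mult_cancel_left using two_neq_zero[OF char_neq_2] by auto
    qed
    with f n show ?thesis by blast
  qed
  have "(\<forall>i\<in>{1..n}. \<forall>j\<in>{1..n}. i \<noteq> j \<longrightarrow> ?b i j + ?b j i = 0) \<longleftrightarrow>
      (\<forall>i\<in>{1..n}. \<forall>j\<in>{1..n}. i < j \<longrightarrow> ?b i j + ?b j i = 0)"
    by (metis add.commute nat_neq_iff)
  also have "\<dots> \<longleftrightarrow> (\<forall>i\<in>{1..n}. \<forall>j\<in>{1..n}. i < j \<longrightarrow>
       coord i (d (e j)) * p i + coord j (d (e i)) * p j = 0 \<and>
       coord i (d (e j)) * q i + coord j (d (e i)) * q j = 0)"
    by (intro ball_cong refl imp_cong off)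
  finally show ?thesis
    unfolding derivation_iff_matrix[OF d] diag by (simp only:)
qed

text \<open>
  The two eigenvector conditions in coordinates. The entry \<open>a 3 3\<close> is \<open>a 2 2\<close> by the diagonal
  condition, so \<open>d (e 2 + e 3) = 2 a 1 1 (e 2 + e 3)\<close> expresses the third column through the second.
\<close>

lemma derivation_iff_scalar:
  assumes d: "Vector_Spaces.linear smul smul d"
  shows "d \<in> derivations smul mul \<longleftrightarrow>
    (\<forall>i\<in>{1..n}. \<forall>j\<in>{1..n}. i < j \<longrightarrow>
       coord i (d (e j)) * p i + coord j (d (e i)) * p j = 0 \<and>
       coord i (d (e j)) * q i + coord j (d (e i)) * q j = 0) \<and>
    (\<forall>i\<in>{1..n}. (p i \<noteq> 0 \<longrightarrow> coord i (d (e i)) = coord 1 (d (e 1))) \<and>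
                (q i \<noteq> 0 \<longrightarrow> coord i (d (e i)) = coord 2 (d (e 2)))) \<and>
    coord 3 (d (e 2)) = 2 * coord 1 (d (e 1)) - coord 2 (d (e 2)) \<and>
    coord 2 (d (e 3)) = 2 * coord 1 (d (e 1)) - coord 2 (d (e 2)) \<and>
    (\<forall>i\<in>{1..n}. i \<noteq> 2 \<and> i \<noteq> 3 \<longrightarrow> coord i (d (e 3)) = - coord i (d (e 2))) \<and>
    (\<forall>i\<in>{1..n}. i \<noteq> n \<longrightarrow> coord i (d (e n)) = 0) \<and>
    coord n (d (e n)) = 2 * coord 2 (d (e 2))"
    (is "_ \<longleftrightarrow> ?off \<and> ?diag \<and> ?a32 \<and> ?a23 \<and> ?col3 \<and> ?coln \<and> ?ann")
proof -
  interpret d: Vector_Spaces.linear smul smul d by (rule d)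
  let ?a = "\<lambda>i j. coord i (d (e j))"
  \<comment> \<open>Rows 2 and 3, and row \<open>n\<close>, play a special part in columns 3 and \<open>n\<close> respectively.\<close>
  have split: "(\<forall>i\<in>{1..n}. Q i) \<longleftrightarrow> Q 2 \<and> Q 3 \<and> (\<forall>i\<in>{1..n}. i \<noteq> 2 \<and> i \<noteq> 3 \<longrightarrow> Q i)"
      "(\<forall>i\<in>{1..n}. Q i) \<longleftrightarrow> (\<forall>i\<in>{1..n}. i \<noteq> n \<longrightarrow> Q i) \<and> Q n" for Q
  proof -
    have mem: "2 \<in> {1..n}" "3 \<in> {1..n}" "n \<in> {1..n}" using dim_ge_4 by auto
    show "(\<forall>i\<in>{1..n}. Q i) \<longleftrightarrow> Q 2 \<and> Q 3 \<and> (\<forall>i\<in>{1..n}. i \<noteq> 2 \<and> i \<noteq> 3 \<longrightarrow> Q i)"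
      using mem(1,2) by metis
    show "(\<forall>i\<in>{1..n}. Q i) \<longleftrightarrow> (\<forall>i\<in>{1..n}. i \<noteq> n \<longrightarrow> Q i) \<and> Q n"
      using mem(3) by metis
  qed
  have col3: "d (e 2 + e 3) = (2 * ?a 1 1) \<cdot> (e 2 + e 3) \<longleftrightarrow> ?a32 \<and> ?a23 \<and> ?col3" if ?diag
  proof -
    have a33: "?a 3 3 = ?a 2 2"
      using bspec[OF that, of 3] square_coeffs dim_ge_4 by simp
    have rhs: "coord i ((2 * ?a 1 1) \<cdot> (e 2 + e 3)) = (if i \<in> {2, 3} then 2 * ?a 1 1 else 0)"
      if "i \<in> {1..n}" for i
      using that dim_ge_4 by (simp add: coord.add coord.scale coord_basis)
    have "d (e 2 + e 3) = (2 * ?a 1 1) \<cdot> (e 2 + e 3) \<longleftrightarrow>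
        (\<forall>i\<in>{1..n}. ?a i 2 + ?a i 3 = (if i \<in> {2, 3} then 2 * ?a 1 1 else 0))"
      unfolding d.add[of "e 2" "e 3"] eq_iff_coord coord.add[of _ "d (e 2)"]
      by (intro ball_cong refl) (simp only: rhs)
    also have "\<dots> \<longleftrightarrow> ?a 2 2 + ?a 2 3 = 2 * ?a 1 1 \<and> ?a 3 2 + ?a 3 3 = 2 * ?a 1 1 \<and>
        (\<forall>i\<in>{1..n}. i \<noteq> 2 \<and> i \<noteq> 3 \<longrightarrow> ?a i 2 + ?a i 3 = 0)"
      by (subst split(1), intro conj_cong ball_cong imp_cong refl) simp_all
    also have "\<dots> \<longleftrightarrow> ?a32 \<and> ?a23 \<and> ?col3"
      unfolding a33 add_eq_0_iff eq_diff_eq add.commute[of "?a 2 2"] by blast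
    finally show ?thesis .
  qed
  have coln: "d (e n) = (2 * ?a 2 2) \<cdot> e n \<longleftrightarrow> ?coln \<and> ?ann"
  proof -
    have rhs: "coord i ((2 * ?a 2 2) \<cdot> e n) = (if i = n then 2 * ?a 2 2 else 0)"
      if "i \<in> {1..n}" for i
      using that dim_ge_4 by (simp add: coord.scale coord_basis)
    have "d (e n) = (2 * ?a 2 2) \<cdot> e n \<longleftrightarrow>
        (\<forall>i\<in>{1..n}. ?a i n = (if i = n then 2 * ?a 2 2 else 0))"
      unfolding eq_iff_coord[of "d (e n)"] by (intro ball_cong refl) (simp only: rhs)
    also have "\<dots> \<longleftrightarrow> ?coln \<and> ?ann"
      by (subst split(2), intro conj_cong ball_cong imp_cong refl) simp_all
    finally show ?thesis .
  qed
  show ?thesis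
    unfolding derivation_iff[OF d] coln using col3 by argo
qed

lemma derivations_eqI:
  assumes "\<And>d. Vector_Spaces.linear smul smul d \<Longrightarrow> d \<in> derivations smul mul \<longleftrightarrow> P d"
  shows "derivations smul mul = {d. Vector_Spaces.linear smul smul d \<and> P d}"
proof -
  have "Vector_Spaces.linear smul smul d" if "d \<in> derivations smul mul" for d
    using that by (simp only: derivations_def mem_Collect_eq)
  with assms show ?thesis by blast
qed

end

section \<open>Small linear systems and coordinate vectors\<close>

lemma unique_zero_of_2_by_2:
  fixes x y a b c d :: "'k::field"
  assumes "a * d - b * c \<noteq> 0" "a * x + c * y = 0" "b * x + d * y = 0"
  shows "x = 0 \<and> y = 0"
proof -
  have "(a * d - b * c) * x = d * (a * x + c * y) - c * (b * x + d * y)"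
    "(a * d - b * c) * y = a * (b * x + d * y) - b * (a * x + c * y)"
    by (simp_all add: algebra_simps)
  then show ?thesis using assms by simp
qed

lemma atLeastAtMost_1_4: "{1..4} = {1, 2, 3, 4::nat}"
  and atLeastAtMost_1_5: "{1..5} = {1, 2, 3, 4, 5::nat}"
  and atLeastAtMost_1_6: "{1..6} = {1, 2, 3, 4, 5, 6::nat}"
  by auto

lemma forall_5: "(\<forall>i::5. P i) \<longleftrightarrow> P 1 \<and> P 2 \<and> P 3 \<and> P 4 \<and> P 5"
proof -
  have "i = 1 \<or> i = 2 \<or> i = 3 \<or> i = 4 \<or> i = 5" for i :: 5
  proof (induct i)
    case (of_int z)
    then have "0 \<le> z" "z < 5" by simp_all
    then have "z = 0 \<or> z = 1 \<or> z = 2 \<or> z = 3 \<or> z = 4" by arith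
    then show ?case by auto
  qed
  then show ?thesis by metis
qed

text \<open>
  The matrix shapes are stated with one quantifier per scalar parameter, the parameter spaces are
  products of spaces \<open>K^m\<close>; the following equivalences pass between the two.
\<close>

lemma ex_vec_2:
  "(\<exists>x::'a^2. P x) \<longleftrightarrow>
    (\<exists>a b. P (\<chi> i. if i = 1 then a else b))"
proof
  assume "\<exists>x. P x"
  then obtain x where "P x" by blast
  moreover have "(\<chi> i. if i = 1 then x$1 else x$2) = x"
    by (simp add: vec_eq_iff forall_2)
  ultimately have "P (\<chi> i. if i = 1 then x$1 else x$2)" by (simp only:)
  then show "\<exists>a b. P (\<chi> i. if i = 1 then a else b)" by blast
qed blast

lemma ex_vec_3:
  "(\<exists>x::'a^3. P x) \<longleftrightarrow>
    (\<exists>a b c. P (\<chi> i. if i = 1 then a else if i = 2 then b else c))"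
proof
  assume "\<exists>x. P x"
  then obtain x where "P x" by blast
  moreover have "(\<chi> i. if i = 1 then x$1 else if i = 2 then x$2 else x$3) = x"
    by (simp add: vec_eq_iff forall_3)
  ultimately have "P (\<chi> i. if i = 1 then x$1 else if i = 2 then x$2 else x$3)" by (simp only:)
  then show "\<exists>a b c. P (\<chi> i. if i = 1 then a else if i = 2 then b else c)" by blast
qed blast

lemma ex_vec_4:
  "(\<exists>x::'a^4. P x) \<longleftrightarrow>
    (\<exists>a b c d. P (\<chi> i. if i = 1 then a else if i = 2 then b else if i = 3 then c else d))"
proof
  assume "\<exists>x. P x"
  then obtain x where "P x" by blast
  moreover have "(\<chi> i. if i = 1 then x$1 else if i = 2 then x$2 else if i = 3 then x$3 else x$4) = x"
    by (simp add: vec_eq_iff forall_4)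
  ultimately have "P (\<chi> i. if i = 1 then x$1 else if i = 2 then x$2 else if i = 3 then x$3 else x$4)" by (simp only:)
  then show "\<exists>a b c d. P (\<chi> i. if i = 1 then a else if i = 2 then b else if i = 3 then c else d)" by blast
qed blast

lemma ex_vec_5:
  "(\<exists>x::'a^5. P x) \<longleftrightarrow>
    (\<exists>a b c d e. P (\<chi> i. if i = 1 then a else if i = 2 then b else if i = 3 then c else if i = 4 then d else e))"
proof
  assume "\<exists>x. P x"
  then obtain x where "P x" by blast
  moreover have "(\<chi> i. if i = 1 then x$1 else if i = 2 then x$2 else if i = 3 then x$3 else if i = 4 then x$4 else x$5) = x"
    by (simp add: vec_eq_iff forall_5)
  ultimately have "P (\<chi> i. if i = 1 then x$1 else if i = 2 then x$2 else if i = 3 then x$3 else if i = 4 then x$4 else x$5)" by (simp only:)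
  then show "\<exists>a b c d e. P (\<chi> i. if i = 1 then a else if i = 2 then b else if i = 3 then c else if i = 4 then d else e)" by blast
qed blast

section \<open>The ten normal forms\<close>

text \<open>
  The functions \<open>p\<close> and \<open>q\<close> of the normal forms: only the squares of \<open>e 4\<close> and \<open>e 5\<close> vary. A parameter
  belonging to the index \<open>n\<close> has to be 0, since the square of \<open>e n\<close> is zero; beyond \<open>n\<close> it is set to 0.
\<close>

definition f_coeff :: "'k::field \<Rightarrow> 'k \<Rightarrow> nat \<Rightarrow> 'k" where
  "f_coeff x y = (\<lambda>_. 0)(1 := 1, 4 := x, 5 := y)"

definition last_coeff :: "'k::field \<Rightarrow> 'k \<Rightarrow> nat \<Rightarrow> 'k" where
  "last_coeff x y = (\<lambda>_. 0)(2 := 1, 3 := -1, 4 := x, 5 := y)"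

lemma plane_squaresI:
  fixes smul :: "'k::field \<Rightarrow> 'v::ab_group_add \<Rightarrow> 'v" (infixr \<open>\<cdot>\<close> 75)
  assumes "CHAR('k) \<noteq> 2" "nonassoc_algebra smul mul" "common_form smul mul n e"
    and "n \<in> {4, 5, 6}"
    and "n = 4 \<Longrightarrow> x = 0 \<and> z = 0" "n \<le> 5 \<Longrightarrow> y = 0 \<and> w = 0"
    and "n > 4 \<Longrightarrow> mul (e 4) (e 4) = x \<cdot> (e 2 + e 3) + z \<cdot> e n"
    and "n > 5 \<Longrightarrow> mul (e 5) (e 5) = y \<cdot> (e 2 + e 3) + w \<cdot> e n"
  shows "plane_squares smul mul n e (f_coeff x y) (last_coeff z w)"
proof -
  interpret vector_space smul using assms(2) by (simp add: nonassoc_algebra_def)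
  have n: "n = 4 \<or> n = 5 \<or> n = 6" using assms(4) by simp
  have form: "natural_basis smul mul n e" "mul (e 1) (e 1) = e 2 + e 3" "mul (e 2) (e 2) = e n"
    "mul (e 3) (e 3) = - e n" "mul (e n) (e n) = 0"
    using assms(3) by (simp_all only: common_form_def)
  have last: "f_coeff x y n = 0" "last_coeff z w n = 0"
    using n assms(5,6) by (auto simp: f_coeff_def last_coeff_def)
  have squares: "mul (e i) (e i) = f_coeff x y i \<cdot> (e 2 + e 3) + last_coeff z w i \<cdot> e n"
    if i: "i \<in> {1..n}" for i
  proof -
    consider "i = 1" | "i = 2" | "i = 3" | "i = 4" "n > 4" | "i = 5" "n > 5" | "i = n"
      using i n by fastforce
    then show ?thesis
    proof cases
      case 6
      then show ?thesis using form(5) last by simp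
    qed (simp_all add: form(2-4) assms(7,8) f_coeff_def last_coeff_def)
  qed
  show ?thesis
  proof (intro plane_squares.intro evolution_basis.intro evolution_basis_axioms.intro
      plane_squares_axioms.intro)
    show "Vector_Spaces.linear smul smul (mul u)" "Vector_Spaces.linear smul smul (\<lambda>v. mul v u)" for u
      using assms(2) by (simp_all only: nonassoc_algebra_def)
    show "4 \<le> n" using n by auto
    show "f_coeff x y 1 = 1" "f_coeff x y 2 = 0" "last_coeff z w 1 = 0" "last_coeff z w 2 = 1"
      "last_coeff z w 3 \<noteq> 0"
      by (simp_all add: f_coeff_def last_coeff_def)
  qed (fact vector_space_axioms assms(1) form(1) squares last)+
qed

context
  fixes smul :: "'k::field \<Rightarrow> 'v::ab_group_add \<Rightarrow> 'v" (infixr \<open>\<cdot>\<close> 75)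
    and mul :: "'v \<Rightarrow> 'v \<Rightarrow> 'v"
    and e :: "nat \<Rightarrow> 'v"
  assumes char: "CHAR('k) \<noteq> 2" and alg: "nonassoc_algebra smul mul"
begin

lemma zero_scale: "0 \<cdot> v = 0"
proof -
  interpret vector_space smul using alg by (simp only: nonassoc_algebra_def)
  show ?thesis by (rule scale_zero_left)
qed


text \<open>
  In each of the ten proofs the scalar system is specialised to the coefficients at hand, and the
  parameter called \<open>dij\<close> is read off as the coefficient of \<open>e i\<close> in \<open>d (e j)\<close>. In the second half \<open>?C\<close>
  lists the columns of the same matrix as a function of a pair of parameter vectors; the value 0 at
  indices outside the basis is a dummy.
\<close>

lemma derivations_N4_6:
  assumes "N4_6 smul mul e"
  shows "derivations smul mul =
    {d. Vector_Spaces.linear smul smul d \<and> (\<exists>d11 d22 d41 d42.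
      d (e 1) = d11 \<cdot> e 1 + d41 \<cdot> e 4 \<and>
      d (e 2) = d22 \<cdot> e 2 + (2 * d11 - d22) \<cdot> e 3 + d42 \<cdot> e 4 \<and>
      d (e 3) = (2 * d11 - d22) \<cdot> e 2 + d22 \<cdot> e 3 - d42 \<cdot> e 4 \<and>
      d (e 4) = (2 * d22) \<cdot> e 4)}"
    (is "_ = {d. _ \<and> ?P d}")
    and "\<exists>\<phi> :: ('k ^ 2) \<times> ('k ^ 2) \<Rightarrow> 'v \<Rightarrow> 'v.
      vector_space_iso_onto (module_prod.scale (*s) (*s)) (fun_scale smul) \<phi> (derivations smul mul)"
    (is ?iso)
proof -
  interpret plane_squares smul mul 4 e "f_coeff 0 0" "last_coeff 0 0"
    using assms by (intro plane_squaresI[OF char alg]) (simp_all add: N4_6_def zero_scale)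
  note coords = coord.add coord.diff coord.neg coord.scale coord_basis atLeastAtMost_1_4
  show eq: "derivations smul mul = {d. Vector_Spaces.linear smul smul d \<and> ?P d}"
  proof (rule derivations_eqI)
    fix d assume d: "Vector_Spaces.linear smul smul d"
    note iff = derivation_iff_scalar[OF d]
    show "d \<in> derivations smul mul \<longleftrightarrow> ?P d"
    proof
      assume "d \<in> derivations smul mul"
      note system = this[unfolded iff atLeastAtMost_1_4 f_coeff_def last_coeff_def, simplified]
      show "?P d"
        using system
        by - (rule exI[of _ "coord 1 (d (e 1))"],
          rule exI[of _ "coord 2 (d (e 2))"],
          rule exI[of _ "coord 4 (d (e 1))"],
          rule exI[of _ "coord 4 (d (e 2))"],
          elim conjE, simp add: eq_iff_coord coords add_eq_0_iff2, (simp add: field_simps)?)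
    next
      assume "?P d"
      then show "d \<in> derivations smul mul"
        unfolding iff
        by (elim exE conjE) (simp add: coords f_coeff_def last_coeff_def, (simp add: field_simps)?)
    qed
  qed
  interpret prod: vector_space_prod "(*s) :: 'k \<Rightarrow> 'k ^ 2 \<Rightarrow> 'k ^ 2" "(*s) :: 'k \<Rightarrow> 'k ^ 2 \<Rightarrow> 'k ^ 2"
    by unfold_locales
  let ?C = "\<lambda>(u :: 'k ^ 2, v :: 'k ^ 2). (\<lambda>_::nat. 0)(
      1 := u$1 \<cdot> e 1 + v$1 \<cdot> e 4,
      2 := u$2 \<cdot> e 2 + (2 * u$1 - u$2) \<cdot> e 3 + v$2 \<cdot> e 4,
      3 := (2 * u$1 - u$2) \<cdot> e 2 + u$2 \<cdot> e 3 - v$2 \<cdot> e 4,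
      4 := (2 * u$2) \<cdot> e 4)"
  show ?iso
  proof (rule iso_onto_linear_family[where C = ?C])
    fix j :: nat assume "j \<in> {1..4}"
    then show "Vector_Spaces.linear prod.scale smul (\<lambda>x. ?C x j)"
      unfolding Vector_Spaces.linear_iff atLeastAtMost_1_4
      using prod.p.vector_space_axioms vector_space_axioms
      by (auto simp: prod.scale_def algebra_simps)
  next
    fix x :: "('k ^ 2) \<times> ('k ^ 2)"
    assume "\<forall>j\<in>{1..4}. ?C x j = 0"
    then show "x = 0"
      by (cases x) (simp add: eq_iff_coord coords zero_prod_def vec_eq_iff forall_2)
  qed (simp_all add: eq prod.p.vector_space_axioms atLeastAtMost_1_4 split_paired_Ex ex_vec_2)
qed

lemma derivations_N5_10:
  assumes "N5_10 smul mul \<alpha> e"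
  shows "derivations smul mul =
    {d. Vector_Spaces.linear smul smul d \<and> (\<exists>d11 d22 d51 d42 d52 d54.
      d (e 1) = d11 \<cdot> e 1 + d51 \<cdot> e 5 \<and>
      d (e 2) = d22 \<cdot> e 2 + (2 * d11 - d22) \<cdot> e 3 + d42 \<cdot> e 4 + d52 \<cdot> e 5 \<and>
      d (e 3) = (2 * d11 - d22) \<cdot> e 2 + d22 \<cdot> e 3 - d42 \<cdot> e 4 - d52 \<cdot> e 5 \<and>
      d (e 4) = - (\<alpha> * d42) \<cdot> e 2 - (\<alpha> * d42) \<cdot> e 3 + d22 \<cdot> e 4 + d54 \<cdot> e 5 \<and>
      d (e 5) = (2 * d22) \<cdot> e 5)}"
    (is "_ = {d. _ \<and> ?P d}")
    and "\<exists>\<phi> :: ('k ^ 3) \<times> ('k ^ 3) \<Rightarrow> 'v \<Rightarrow> 'v.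
      vector_space_iso_onto (module_prod.scale (*s) (*s)) (fun_scale smul) \<phi> (derivations smul mul)"
    (is ?iso)
proof -
  interpret plane_squares smul mul 5 e "f_coeff 0 0" "last_coeff \<alpha> 0"
    using assms by (intro plane_squaresI[OF char alg]) (simp_all add: N5_10_def zero_scale)
  have nonzero: "\<alpha> \<noteq> 0"
    using assms by (simp_all add: N5_10_def)
  note [simp] = nonzero
  note coords = coord.add coord.diff coord.neg coord.scale coord_basis atLeastAtMost_1_5
  show eq: "derivations smul mul = {d. Vector_Spaces.linear smul smul d \<and> ?P d}"
  proof (rule derivations_eqI)
    fix d assume d: "Vector_Spaces.linear smul smul d"
    note iff = derivation_iff_scalar[OF d]
    show "d \<in> derivations smul mul \<longleftrightarrow> ?P d"
    proof
      assume "d \<in> derivations smul mul"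
      note system = this[unfolded iff atLeastAtMost_1_5 f_coeff_def last_coeff_def, simplified]
      show "?P d"
        using system
        by - (rule exI[of _ "coord 1 (d (e 1))"],
          rule exI[of _ "coord 2 (d (e 2))"],
          rule exI[of _ "coord 5 (d (e 1))"],
          rule exI[of _ "coord 4 (d (e 2))"],
          rule exI[of _ "coord 5 (d (e 2))"],
          rule exI[of _ "coord 5 (d (e 4))"],
          elim conjE, simp add: eq_iff_coord coords add_eq_0_iff2, (simp add: field_simps)?)
    next
      assume "?P d"
      then show "d \<in> derivations smul mul"
        unfolding iff
        by (elim exE conjE) (simp add: coords f_coeff_def last_coeff_def, (simp add: field_simps)?)
    qed
  qed
  interpret prod: vector_space_prod "(*s) :: 'k \<Rightarrow> 'k ^ 3 \<Rightarrow> 'k ^ 3" "(*s) :: 'k \<Rightarrow> 'k ^ 3 \<Rightarrow> 'k ^ 3"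
    by unfold_locales
  let ?C = "\<lambda>(u :: 'k ^ 3, v :: 'k ^ 3). (\<lambda>_::nat. 0)(
      1 := u$1 \<cdot> e 1 + u$3 \<cdot> e 5,
      2 := u$2 \<cdot> e 2 + (2 * u$1 - u$2) \<cdot> e 3 + v$1 \<cdot> e 4 + v$2 \<cdot> e 5,
      3 := (2 * u$1 - u$2) \<cdot> e 2 + u$2 \<cdot> e 3 - v$1 \<cdot> e 4 - v$2 \<cdot> e 5,
      4 := - (\<alpha> * v$1) \<cdot> e 2 - (\<alpha> * v$1) \<cdot> e 3 + u$2 \<cdot> e 4 + v$3 \<cdot> e 5,
      5 := (2 * u$2) \<cdot> e 5)"
  show ?iso
  proof (rule iso_onto_linear_family[where C = ?C])
    fix j :: nat assume "j \<in> {1..5}"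
    then show "Vector_Spaces.linear prod.scale smul (\<lambda>x. ?C x j)"
      unfolding Vector_Spaces.linear_iff atLeastAtMost_1_5
      using prod.p.vector_space_axioms vector_space_axioms
      by (auto simp: prod.scale_def algebra_simps)
  next
    fix x :: "('k ^ 3) \<times> ('k ^ 3)"
    assume "\<forall>j\<in>{1..5}. ?C x j = 0"
    then show "x = 0"
      by (cases x) (simp add: eq_iff_coord coords zero_prod_def vec_eq_iff forall_3)
  qed (simp_all add: eq prod.p.vector_space_axioms atLeastAtMost_1_5 split_paired_Ex ex_vec_3)
qed

lemma derivations_N5_11:
  assumes "N5_11 smul mul \<alpha> e"
  shows "derivations smul mul =
    {d. Vector_Spaces.linear smul smul d \<and> (\<exists>d11 d22 d41 d51 d52 d54.
      d (e 1) = d11 \<cdot> e 1 + d41 \<cdot> e 4 + d51 \<cdot> e 5 \<and>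
      d (e 2) = d22 \<cdot> e 2 + (2 * d11 - d22) \<cdot> e 3 + d52 \<cdot> e 5 \<and>
      d (e 3) = (2 * d11 - d22) \<cdot> e 2 + d22 \<cdot> e 3 - d52 \<cdot> e 5 \<and>
      d (e 4) = - (\<alpha> * d41) \<cdot> e 1 + d11 \<cdot> e 4 + d54 \<cdot> e 5 \<and>
      d (e 5) = (2 * d22) \<cdot> e 5)}"
    (is "_ = {d. _ \<and> ?P d}")
    and "\<exists>\<phi> :: ('k ^ 3) \<times> ('k ^ 3) \<Rightarrow> 'v \<Rightarrow> 'v.
      vector_space_iso_onto (module_prod.scale (*s) (*s)) (fun_scale smul) \<phi> (derivations smul mul)"
    (is ?iso)
proof -
  interpret plane_squares smul mul 5 e "f_coeff \<alpha> 0" "last_coeff 0 0"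
    using assms by (intro plane_squaresI[OF char alg]) (simp_all add: N5_11_def zero_scale)
  have nonzero: "\<alpha> \<noteq> 0"
    using assms by (simp_all add: N5_11_def)
  note [simp] = nonzero
  note coords = coord.add coord.diff coord.neg coord.scale coord_basis atLeastAtMost_1_5
  show eq: "derivations smul mul = {d. Vector_Spaces.linear smul smul d \<and> ?P d}"
  proof (rule derivations_eqI)
    fix d assume d: "Vector_Spaces.linear smul smul d"
    note iff = derivation_iff_scalar[OF d]
    show "d \<in> derivations smul mul \<longleftrightarrow> ?P d"
    proof
      assume "d \<in> derivations smul mul"
      note system = this[unfolded iff atLeastAtMost_1_5 f_coeff_def last_coeff_def, simplified]
      show "?P d"
        using system
        by - (rule exI[of _ "coord 1 (d (e 1))"],
          rule exI[of _ "coord 2 (d (e 2))"],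
          rule exI[of _ "coord 4 (d (e 1))"],
          rule exI[of _ "coord 5 (d (e 1))"],
          rule exI[of _ "coord 5 (d (e 2))"],
          rule exI[of _ "coord 5 (d (e 4))"],
          elim conjE, simp add: eq_iff_coord coords add_eq_0_iff2, (simp add: field_simps)?)
    next
      assume "?P d"
      then show "d \<in> derivations smul mul"
        unfolding iff
        by (elim exE conjE) (simp add: coords f_coeff_def last_coeff_def, (simp add: field_simps)?)
    qed
  qed
  interpret prod: vector_space_prod "(*s) :: 'k \<Rightarrow> 'k ^ 3 \<Rightarrow> 'k ^ 3" "(*s) :: 'k \<Rightarrow> 'k ^ 3 \<Rightarrow> 'k ^ 3"
    by unfold_locales
  let ?C = "\<lambda>(u :: 'k ^ 3, v :: 'k ^ 3). (\<lambda>_::nat. 0)(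
      1 := u$1 \<cdot> e 1 + u$3 \<cdot> e 4 + v$1 \<cdot> e 5,
      2 := u$2 \<cdot> e 2 + (2 * u$1 - u$2) \<cdot> e 3 + v$2 \<cdot> e 5,
      3 := (2 * u$1 - u$2) \<cdot> e 2 + u$2 \<cdot> e 3 - v$2 \<cdot> e 5,
      4 := - (\<alpha> * u$3) \<cdot> e 1 + u$1 \<cdot> e 4 + v$3 \<cdot> e 5,
      5 := (2 * u$2) \<cdot> e 5)"
  show ?iso
  proof (rule iso_onto_linear_family[where C = ?C])
    fix j :: nat assume "j \<in> {1..5}"
    then show "Vector_Spaces.linear prod.scale smul (\<lambda>x. ?C x j)"
      unfolding Vector_Spaces.linear_iff atLeastAtMost_1_5
      using prod.p.vector_space_axioms vector_space_axioms
      by (auto simp: prod.scale_def algebra_simps)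
  next
    fix x :: "('k ^ 3) \<times> ('k ^ 3)"
    assume "\<forall>j\<in>{1..5}. ?C x j = 0"
    then show "x = 0"
      by (cases x) (simp add: eq_iff_coord coords zero_prod_def vec_eq_iff forall_3)
  qed (simp_all add: eq prod.p.vector_space_axioms atLeastAtMost_1_5 split_paired_Ex ex_vec_3)
qed

text \<open>
  Here \<open>e 4 \<odot> e 4\<close> has components along both \<open>e 2 + e 3\<close> and \<open>e 5\<close>, so the diagonal entry of column 4
  equals those of columns 1 and 2; this is what identifies \<open>d22\<close> with \<open>d11\<close>.
\<close>

lemma derivations_N5_12:
  assumes "N5_12 smul mul \<alpha> \<beta> e"
  shows "derivations smul mul =
    {d. Vector_Spaces.linear smul smul d \<and> (\<exists>d11 d51 d52 d54.
      d (e 1) = d11 \<cdot> e 1 + d51 \<cdot> e 5 \<and>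
      d (e 2) = d11 \<cdot> e 2 + d11 \<cdot> e 3 + d52 \<cdot> e 5 \<and>
      d (e 3) = d11 \<cdot> e 2 + d11 \<cdot> e 3 - d52 \<cdot> e 5 \<and>
      d (e 4) = d11 \<cdot> e 4 + d54 \<cdot> e 5 \<and>
      d (e 5) = (2 * d11) \<cdot> e 5)}"
    (is "_ = {d. _ \<and> ?P d}")
    and "\<exists>\<phi> :: 'k \<times> ('k ^ 3) \<Rightarrow> 'v \<Rightarrow> 'v.
      vector_space_iso_onto (module_prod.scale (*) (*s)) (fun_scale smul) \<phi> (derivations smul mul)"
    (is ?iso)
proof -
  interpret plane_squares smul mul 5 e "f_coeff \<alpha> 0" "last_coeff \<beta> 0"
    using assms by (intro plane_squaresI[OF char alg]) (simp_all add: N5_12_def zero_scale)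
  have nonzero: "\<alpha> \<noteq> 0" "\<beta> \<noteq> 0"
    using assms by (simp_all add: N5_12_def)
  note [simp] = nonzero
  note coords = coord.add coord.diff coord.neg coord.scale coord_basis atLeastAtMost_1_5
  show eq: "derivations smul mul = {d. Vector_Spaces.linear smul smul d \<and> ?P d}"
  proof (rule derivations_eqI)
    fix d assume d: "Vector_Spaces.linear smul smul d"
    note iff = derivation_iff_scalar[OF d]
    show "d \<in> derivations smul mul \<longleftrightarrow> ?P d"
    proof
      assume "d \<in> derivations smul mul"
      note system = this[unfolded iff atLeastAtMost_1_5 f_coeff_def last_coeff_def, simplified]
      show "?P d"
        using system
        by - (rule exI[of _ "coord 1 (d (e 1))"],
          rule exI[of _ "coord 5 (d (e 1))"],
          rule exI[of _ "coord 5 (d (e 2))"],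
          rule exI[of _ "coord 5 (d (e 4))"],
          elim conjE, simp add: eq_iff_coord coords add_eq_0_iff2, (simp add: field_simps)?)
    next
      assume "?P d"
      then show "d \<in> derivations smul mul"
        unfolding iff
        by (elim exE conjE) (simp add: coords f_coeff_def last_coeff_def, (simp add: field_simps)?)
    qed
  qed
  interpret prod: vector_space_prod "(*) :: 'k \<Rightarrow> 'k \<Rightarrow> 'k" "(*s) :: 'k \<Rightarrow> 'k ^ 3 \<Rightarrow> 'k ^ 3"
    by unfold_locales
  let ?C = "\<lambda>(u :: 'k, v :: 'k ^ 3). (\<lambda>_::nat. 0)(
      1 := u \<cdot> e 1 + v$1 \<cdot> e 5,
      2 := u \<cdot> e 2 + u \<cdot> e 3 + v$2 \<cdot> e 5,
      3 := u \<cdot> e 2 + u \<cdot> e 3 - v$2 \<cdot> e 5,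
      4 := u \<cdot> e 4 + v$3 \<cdot> e 5,
      5 := (2 * u) \<cdot> e 5)"
  show ?iso
  proof (rule iso_onto_linear_family[where C = ?C])
    fix j :: nat assume "j \<in> {1..5}"
    then show "Vector_Spaces.linear prod.scale smul (\<lambda>x. ?C x j)"
      unfolding Vector_Spaces.linear_iff atLeastAtMost_1_5
      using prod.p.vector_space_axioms vector_space_axioms
      by (auto simp: prod.scale_def algebra_simps)
  next
    fix x :: "'k \<times> ('k ^ 3)"
    assume "\<forall>j\<in>{1..5}. ?C x j = 0"
    then show "x = 0"
      by (cases x) (simp add: eq_iff_coord coords zero_prod_def vec_eq_iff forall_3)
  qed (simp_all add: eq prod.p.vector_space_axioms atLeastAtMost_1_5 split_paired_Ex ex_vec_3)
qed

text \<open>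
  The squares of \<open>e 4\<close> and \<open>e 5\<close> are proportional to each other and to those of \<open>e 2\<close> and \<open>e 3\<close>, so all
  four vectors may occur in each other's images.
\<close>

lemma derivations_N6_19:
  assumes "N6_19 smul mul \<alpha> \<beta> e"
  shows "derivations smul mul =
    {d. Vector_Spaces.linear smul smul d \<and> (\<exists>d11 d22 d61 d42 d52 d62 d54 d64 d65.
      d (e 1) = d11 \<cdot> e 1 + d61 \<cdot> e 6 \<and>
      d (e 2) = d22 \<cdot> e 2 + (2 * d11 - d22) \<cdot> e 3 + d42 \<cdot> e 4 + d52 \<cdot> e 5 + d62 \<cdot> e 6 \<and>
      d (e 3) = (2 * d11 - d22) \<cdot> e 2 + d22 \<cdot> e 3 - d42 \<cdot> e 4 - d52 \<cdot> e 5 - d62 \<cdot> e 6 \<and>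
      d (e 4) = - (\<alpha> * d42) \<cdot> e 2 - (\<alpha> * d42) \<cdot> e 3 + d22 \<cdot> e 4 + d54 \<cdot> e 5 + d64 \<cdot> e 6 \<and>
      d (e 5) = - (\<beta> * d52) \<cdot> e 2 - (\<beta> * d52) \<cdot> e 3 - (inverse \<alpha> * \<beta> * d54) \<cdot> e 4 + d22 \<cdot> e 5 + d65 \<cdot> e 6 \<and>
      d (e 6) = (2 * d22) \<cdot> e 6)}"
    (is "_ = {d. _ \<and> ?P d}")
    and "\<exists>\<phi> :: ('k ^ 5) \<times> ('k ^ 4) \<Rightarrow> 'v \<Rightarrow> 'v.
      vector_space_iso_onto (module_prod.scale (*s) (*s)) (fun_scale smul) \<phi> (derivations smul mul)"
    (is ?iso)
proof -
  interpret plane_squares smul mul 6 e "f_coeff 0 0" "last_coeff \<alpha> \<beta>"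
    using assms by (intro plane_squaresI[OF char alg]) (simp_all add: N6_19_def zero_scale)
  have nonzero: "\<alpha> \<noteq> 0" "\<beta> \<noteq> 0"
    using assms by (simp_all add: N6_19_def)
  note [simp] = nonzero
  note coords = coord.add coord.diff coord.neg coord.scale coord_basis atLeastAtMost_1_6
  show eq: "derivations smul mul = {d. Vector_Spaces.linear smul smul d \<and> ?P d}"
  proof (rule derivations_eqI)
    fix d assume d: "Vector_Spaces.linear smul smul d"
    note iff = derivation_iff_scalar[OF d]
    show "d \<in> derivations smul mul \<longleftrightarrow> ?P d"
    proof
      assume "d \<in> derivations smul mul"
      note system = this[unfolded iff atLeastAtMost_1_6 f_coeff_def last_coeff_def, simplified]
      show "?P d"
        using system
        by - (rule exI[of _ "coord 1 (d (e 1))"],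
          rule exI[of _ "coord 2 (d (e 2))"],
          rule exI[of _ "coord 6 (d (e 1))"],
          rule exI[of _ "coord 4 (d (e 2))"],
          rule exI[of _ "coord 5 (d (e 2))"],
          rule exI[of _ "coord 6 (d (e 2))"],
          rule exI[of _ "coord 5 (d (e 4))"],
          rule exI[of _ "coord 6 (d (e 4))"],
          rule exI[of _ "coord 6 (d (e 5))"],
          elim conjE, simp add: eq_iff_coord coords add_eq_0_iff2, (simp add: field_simps)?)
    next
      assume "?P d"
      then show "d \<in> derivations smul mul"
        unfolding iff
        by (elim exE conjE) (simp add: coords f_coeff_def last_coeff_def, (simp add: field_simps)?)
    qed
  qed
  interpret prod: vector_space_prod "(*s) :: 'k \<Rightarrow> 'k ^ 5 \<Rightarrow> 'k ^ 5" "(*s) :: 'k \<Rightarrow> 'k ^ 4 \<Rightarrow> 'k ^ 4"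
    by unfold_locales
  let ?C = "\<lambda>(u :: 'k ^ 5, v :: 'k ^ 4). (\<lambda>_::nat. 0)(
      1 := u$1 \<cdot> e 1 + u$3 \<cdot> e 6,
      2 := u$2 \<cdot> e 2 + (2 * u$1 - u$2) \<cdot> e 3 + u$4 \<cdot> e 4 + u$5 \<cdot> e 5 + v$1 \<cdot> e 6,
      3 := (2 * u$1 - u$2) \<cdot> e 2 + u$2 \<cdot> e 3 - u$4 \<cdot> e 4 - u$5 \<cdot> e 5 - v$1 \<cdot> e 6,
      4 := - (\<alpha> * u$4) \<cdot> e 2 - (\<alpha> * u$4) \<cdot> e 3 + u$2 \<cdot> e 4 + v$2 \<cdot> e 5 + v$3 \<cdot> e 6,
      5 := - (\<beta> * u$5) \<cdot> e 2 - (\<beta> * u$5) \<cdot> e 3 - (inverse \<alpha> * \<beta> * v$2) \<cdot> e 4 + u$2 \<cdot> e 5 + v$4 \<cdot> e 6,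
      6 := (2 * u$2) \<cdot> e 6)"
  show ?iso
  proof (rule iso_onto_linear_family[where C = ?C])
    fix j :: nat assume "j \<in> {1..6}"
    then show "Vector_Spaces.linear prod.scale smul (\<lambda>x. ?C x j)"
      unfolding Vector_Spaces.linear_iff atLeastAtMost_1_6
      using prod.p.vector_space_axioms vector_space_axioms
      by (auto simp: prod.scale_def algebra_simps)
  next
    fix x :: "('k ^ 5) \<times> ('k ^ 4)"
    assume "\<forall>j\<in>{1..6}. ?C x j = 0"
    then show "x = 0"
      by (cases x) (simp add: eq_iff_coord coords zero_prod_def vec_eq_iff forall_4 forall_5)
  qed (simp_all add: eq prod.p.vector_space_axioms atLeastAtMost_1_6 split_paired_Ex ex_vec_4 ex_vec_5)
qed

lemma derivations_N6_20:
  assumes "N6_20 smul mul \<alpha> \<beta> e"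
  shows "derivations smul mul =
    {d. Vector_Spaces.linear smul smul d \<and> (\<exists>d11 d22 d41 d61 d52 d62 d64 d65.
      d (e 1) = d11 \<cdot> e 1 + d41 \<cdot> e 4 + d61 \<cdot> e 6 \<and>
      d (e 2) = d22 \<cdot> e 2 + (2 * d11 - d22) \<cdot> e 3 + d52 \<cdot> e 5 + d62 \<cdot> e 6 \<and>
      d (e 3) = (2 * d11 - d22) \<cdot> e 2 + d22 \<cdot> e 3 - d52 \<cdot> e 5 - d62 \<cdot> e 6 \<and>
      d (e 4) = - (\<alpha> * d41) \<cdot> e 1 + d11 \<cdot> e 4 + d64 \<cdot> e 6 \<and>
      d (e 5) = - (\<beta> * d52) \<cdot> e 2 - (\<beta> * d52) \<cdot> e 3 + d22 \<cdot> e 5 + d65 \<cdot> e 6 \<and>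
      d (e 6) = (2 * d22) \<cdot> e 6)}"
    (is "_ = {d. _ \<and> ?P d}")
    and "\<exists>\<phi> :: ('k ^ 4) \<times> ('k ^ 4) \<Rightarrow> 'v \<Rightarrow> 'v.
      vector_space_iso_onto (module_prod.scale (*s) (*s)) (fun_scale smul) \<phi> (derivations smul mul)"
    (is ?iso)
proof -
  interpret plane_squares smul mul 6 e "f_coeff \<alpha> 0" "last_coeff 0 \<beta>"
    using assms by (intro plane_squaresI[OF char alg]) (simp_all add: N6_20_def zero_scale)
  have nonzero: "\<alpha> \<noteq> 0" "\<beta> \<noteq> 0"
    using assms by (simp_all add: N6_20_def)
  note [simp] = nonzero
  note coords = coord.add coord.diff coord.neg coord.scale coord_basis atLeastAtMost_1_6
  show eq: "derivations smul mul = {d. Vector_Spaces.linear smul smul d \<and> ?P d}"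
  proof (rule derivations_eqI)
    fix d assume d: "Vector_Spaces.linear smul smul d"
    note iff = derivation_iff_scalar[OF d]
    show "d \<in> derivations smul mul \<longleftrightarrow> ?P d"
    proof
      assume "d \<in> derivations smul mul"
      note system = this[unfolded iff atLeastAtMost_1_6 f_coeff_def last_coeff_def, simplified]
      show "?P d"
        using system
        by - (rule exI[of _ "coord 1 (d (e 1))"],
          rule exI[of _ "coord 2 (d (e 2))"],
          rule exI[of _ "coord 4 (d (e 1))"],
          rule exI[of _ "coord 6 (d (e 1))"],
          rule exI[of _ "coord 5 (d (e 2))"],
          rule exI[of _ "coord 6 (d (e 2))"],
          rule exI[of _ "coord 6 (d (e 4))"],
          rule exI[of _ "coord 6 (d (e 5))"],
          elim conjE, simp add: eq_iff_coord coords add_eq_0_iff2, (simp add: field_simps)?)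
    next
      assume "?P d"
      then show "d \<in> derivations smul mul"
        unfolding iff
        by (elim exE conjE) (simp add: coords f_coeff_def last_coeff_def, (simp add: field_simps)?)
    qed
  qed
  interpret prod: vector_space_prod "(*s) :: 'k \<Rightarrow> 'k ^ 4 \<Rightarrow> 'k ^ 4" "(*s) :: 'k \<Rightarrow> 'k ^ 4 \<Rightarrow> 'k ^ 4"
    by unfold_locales
  let ?C = "\<lambda>(u :: 'k ^ 4, v :: 'k ^ 4). (\<lambda>_::nat. 0)(
      1 := u$1 \<cdot> e 1 + u$3 \<cdot> e 4 + u$4 \<cdot> e 6,
      2 := u$2 \<cdot> e 2 + (2 * u$1 - u$2) \<cdot> e 3 + v$1 \<cdot> e 5 + v$2 \<cdot> e 6,
      3 := (2 * u$1 - u$2) \<cdot> e 2 + u$2 \<cdot> e 3 - v$1 \<cdot> e 5 - v$2 \<cdot> e 6,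
      4 := - (\<alpha> * u$3) \<cdot> e 1 + u$1 \<cdot> e 4 + v$3 \<cdot> e 6,
      5 := - (\<beta> * v$1) \<cdot> e 2 - (\<beta> * v$1) \<cdot> e 3 + u$2 \<cdot> e 5 + v$4 \<cdot> e 6,
      6 := (2 * u$2) \<cdot> e 6)"
  show ?iso
  proof (rule iso_onto_linear_family[where C = ?C])
    fix j :: nat assume "j \<in> {1..6}"
    then show "Vector_Spaces.linear prod.scale smul (\<lambda>x. ?C x j)"
      unfolding Vector_Spaces.linear_iff atLeastAtMost_1_6
      using prod.p.vector_space_axioms vector_space_axioms
      by (auto simp: prod.scale_def algebra_simps)
  next
    fix x :: "('k ^ 4) \<times> ('k ^ 4)"
    assume "\<forall>j\<in>{1..6}. ?C x j = 0"
    then show "x = 0"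
      by (cases x) (simp add: eq_iff_coord coords zero_prod_def vec_eq_iff forall_4)
  qed (simp_all add: eq prod.p.vector_space_axioms atLeastAtMost_1_6 split_paired_Ex ex_vec_4)
qed

lemma derivations_N6_21:
  assumes "N6_21 smul mul \<alpha> \<beta> \<gamma> e"
  shows "derivations smul mul =
    {d. Vector_Spaces.linear smul smul d \<and> (\<exists>d11 d61 d52 d62 d64 d65.
      d (e 1) = d11 \<cdot> e 1 + d61 \<cdot> e 6 \<and>
      d (e 2) = d11 \<cdot> e 2 + d11 \<cdot> e 3 + d52 \<cdot> e 5 + d62 \<cdot> e 6 \<and>
      d (e 3) = d11 \<cdot> e 2 + d11 \<cdot> e 3 - d52 \<cdot> e 5 - d62 \<cdot> e 6 \<and>
      d (e 4) = d11 \<cdot> e 4 + d64 \<cdot> e 6 \<and>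
      d (e 5) = - (\<gamma> * d52) \<cdot> e 2 - (\<gamma> * d52) \<cdot> e 3 + d11 \<cdot> e 5 + d65 \<cdot> e 6 \<and>
      d (e 6) = (2 * d11) \<cdot> e 6)}"
    (is "_ = {d. _ \<and> ?P d}")
    and "\<exists>\<phi> :: ('k ^ 2) \<times> ('k ^ 4) \<Rightarrow> 'v \<Rightarrow> 'v.
      vector_space_iso_onto (module_prod.scale (*s) (*s)) (fun_scale smul) \<phi> (derivations smul mul)"
    (is ?iso)
proof -
  interpret plane_squares smul mul 6 e "f_coeff \<alpha> 0" "last_coeff \<beta> \<gamma>"
    using assms by (intro plane_squaresI[OF char alg]) (simp_all add: N6_21_def zero_scale)
  have nonzero: "\<alpha> \<noteq> 0" "\<beta> \<noteq> 0" "\<gamma> \<noteq> 0"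
    using assms by (simp_all add: N6_21_def)
  note [simp] = nonzero
  note coords = coord.add coord.diff coord.neg coord.scale coord_basis atLeastAtMost_1_6
  show eq: "derivations smul mul = {d. Vector_Spaces.linear smul smul d \<and> ?P d}"
  proof (rule derivations_eqI)
    fix d assume d: "Vector_Spaces.linear smul smul d"
    note iff = derivation_iff_scalar[OF d]
    show "d \<in> derivations smul mul \<longleftrightarrow> ?P d"
    proof
      assume "d \<in> derivations smul mul"
      note system = this[unfolded iff atLeastAtMost_1_6 f_coeff_def last_coeff_def, simplified]
      show "?P d"
        using system
        by - (rule exI[of _ "coord 1 (d (e 1))"],
          rule exI[of _ "coord 6 (d (e 1))"],
          rule exI[of _ "coord 5 (d (e 2))"],
          rule exI[of _ "coord 6 (d (e 2))"],
          rule exI[of _ "coord 6 (d (e 4))"],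
          rule exI[of _ "coord 6 (d (e 5))"],
          elim conjE, simp add: eq_iff_coord coords add_eq_0_iff2, (simp add: field_simps)?)
    next
      assume "?P d"
      then show "d \<in> derivations smul mul"
        unfolding iff
        by (elim exE conjE) (simp add: coords f_coeff_def last_coeff_def, (simp add: field_simps)?)
    qed
  qed
  interpret prod: vector_space_prod "(*s) :: 'k \<Rightarrow> 'k ^ 2 \<Rightarrow> 'k ^ 2" "(*s) :: 'k \<Rightarrow> 'k ^ 4 \<Rightarrow> 'k ^ 4"
    by unfold_locales
  let ?C = "\<lambda>(u :: 'k ^ 2, v :: 'k ^ 4). (\<lambda>_::nat. 0)(
      1 := u$1 \<cdot> e 1 + u$2 \<cdot> e 6,
      2 := u$1 \<cdot> e 2 + u$1 \<cdot> e 3 + v$1 \<cdot> e 5 + v$2 \<cdot> e 6,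
      3 := u$1 \<cdot> e 2 + u$1 \<cdot> e 3 - v$1 \<cdot> e 5 - v$2 \<cdot> e 6,
      4 := u$1 \<cdot> e 4 + v$3 \<cdot> e 6,
      5 := - (\<gamma> * v$1) \<cdot> e 2 - (\<gamma> * v$1) \<cdot> e 3 + u$1 \<cdot> e 5 + v$4 \<cdot> e 6,
      6 := (2 * u$1) \<cdot> e 6)"
  show ?iso
  proof (rule iso_onto_linear_family[where C = ?C])
    fix j :: nat assume "j \<in> {1..6}"
    then show "Vector_Spaces.linear prod.scale smul (\<lambda>x. ?C x j)"
      unfolding Vector_Spaces.linear_iff atLeastAtMost_1_6
      using prod.p.vector_space_axioms vector_space_axioms
      by (auto simp: prod.scale_def algebra_simps)
  next
    fix x :: "('k ^ 2) \<times> ('k ^ 4)"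
    assume "\<forall>j\<in>{1..6}. ?C x j = 0"
    then show "x = 0"
      by (cases x) (simp add: eq_iff_coord coords zero_prod_def vec_eq_iff forall_2 forall_4)
  qed (simp_all add: eq prod.p.vector_space_axioms atLeastAtMost_1_6 split_paired_Ex ex_vec_2 ex_vec_4)
qed

text \<open>
  The squares of \<open>e 1\<close>, \<open>e 4\<close>, \<open>e 5\<close> are all proportional to \<open>e 2 + e 3\<close>, so these three may occur in
  each other's images.
\<close>

lemma derivations_N6_22:
  assumes "N6_22 smul mul \<alpha> \<beta> e"
  shows "derivations smul mul =
    {d. Vector_Spaces.linear smul smul d \<and> (\<exists>d11 d22 d41 d51 d61 d62 d54 d64 d65.
      d (e 1) = d11 \<cdot> e 1 + d41 \<cdot> e 4 + d51 \<cdot> e 5 + d61 \<cdot> e 6 \<and>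
      d (e 2) = d22 \<cdot> e 2 + (2 * d11 - d22) \<cdot> e 3 + d62 \<cdot> e 6 \<and>
      d (e 3) = (2 * d11 - d22) \<cdot> e 2 + d22 \<cdot> e 3 - d62 \<cdot> e 6 \<and>
      d (e 4) = - (\<alpha> * d41) \<cdot> e 1 + d11 \<cdot> e 4 + d54 \<cdot> e 5 + d64 \<cdot> e 6 \<and>
      d (e 5) = - (\<beta> * d51) \<cdot> e 1 - (inverse \<alpha> * \<beta> * d54) \<cdot> e 4 + d11 \<cdot> e 5 + d65 \<cdot> e 6 \<and>
      d (e 6) = (2 * d22) \<cdot> e 6)}"
    (is "_ = {d. _ \<and> ?P d}")
    and "\<exists>\<phi> :: ('k ^ 5) \<times> ('k ^ 4) \<Rightarrow> 'v \<Rightarrow> 'v.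
      vector_space_iso_onto (module_prod.scale (*s) (*s)) (fun_scale smul) \<phi> (derivations smul mul)"
    (is ?iso)
proof -
  interpret plane_squares smul mul 6 e "f_coeff \<alpha> \<beta>" "last_coeff 0 0"
    using assms by (intro plane_squaresI[OF char alg]) (simp_all add: N6_22_def zero_scale)
  have nonzero: "\<alpha> \<noteq> 0" "\<beta> \<noteq> 0"
    using assms by (simp_all add: N6_22_def)
  note [simp] = nonzero
  note coords = coord.add coord.diff coord.neg coord.scale coord_basis atLeastAtMost_1_6
  show eq: "derivations smul mul = {d. Vector_Spaces.linear smul smul d \<and> ?P d}"
  proof (rule derivations_eqI)
    fix d assume d: "Vector_Spaces.linear smul smul d"
    note iff = derivation_iff_scalar[OF d]
    show "d \<in> derivations smul mul \<longleftrightarrow> ?P d"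
    proof
      assume "d \<in> derivations smul mul"
      note system = this[unfolded iff atLeastAtMost_1_6 f_coeff_def last_coeff_def, simplified]
      show "?P d"
        using system
        by - (rule exI[of _ "coord 1 (d (e 1))"],
          rule exI[of _ "coord 2 (d (e 2))"],
          rule exI[of _ "coord 4 (d (e 1))"],
          rule exI[of _ "coord 5 (d (e 1))"],
          rule exI[of _ "coord 6 (d (e 1))"],
          rule exI[of _ "coord 6 (d (e 2))"],
          rule exI[of _ "coord 5 (d (e 4))"],
          rule exI[of _ "coord 6 (d (e 4))"],
          rule exI[of _ "coord 6 (d (e 5))"],
          elim conjE, simp add: eq_iff_coord coords add_eq_0_iff2, (simp add: field_simps)?)
    next
      assume "?P d"
      then show "d \<in> derivations smul mul"
        unfolding iff
        by (elim exE conjE) (simp add: coords f_coeff_def last_coeff_def, (simp add: field_simps)?)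
    qed
  qed
  interpret prod: vector_space_prod "(*s) :: 'k \<Rightarrow> 'k ^ 5 \<Rightarrow> 'k ^ 5" "(*s) :: 'k \<Rightarrow> 'k ^ 4 \<Rightarrow> 'k ^ 4"
    by unfold_locales
  let ?C = "\<lambda>(u :: 'k ^ 5, v :: 'k ^ 4). (\<lambda>_::nat. 0)(
      1 := u$1 \<cdot> e 1 + u$3 \<cdot> e 4 + u$4 \<cdot> e 5 + u$5 \<cdot> e 6,
      2 := u$2 \<cdot> e 2 + (2 * u$1 - u$2) \<cdot> e 3 + v$1 \<cdot> e 6,
      3 := (2 * u$1 - u$2) \<cdot> e 2 + u$2 \<cdot> e 3 - v$1 \<cdot> e 6,
      4 := - (\<alpha> * u$3) \<cdot> e 1 + u$1 \<cdot> e 4 + v$2 \<cdot> e 5 + v$3 \<cdot> e 6,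
      5 := - (\<beta> * u$4) \<cdot> e 1 - (inverse \<alpha> * \<beta> * v$2) \<cdot> e 4 + u$1 \<cdot> e 5 + v$4 \<cdot> e 6,
      6 := (2 * u$2) \<cdot> e 6)"
  show ?iso
  proof (rule iso_onto_linear_family[where C = ?C])
    fix j :: nat assume "j \<in> {1..6}"
    then show "Vector_Spaces.linear prod.scale smul (\<lambda>x. ?C x j)"
      unfolding Vector_Spaces.linear_iff atLeastAtMost_1_6
      using prod.p.vector_space_axioms vector_space_axioms
      by (auto simp: prod.scale_def algebra_simps)
  next
    fix x :: "('k ^ 5) \<times> ('k ^ 4)"
    assume "\<forall>j\<in>{1..6}. ?C x j = 0"
    then show "x = 0"
      by (cases x) (simp add: eq_iff_coord coords zero_prod_def vec_eq_iff forall_4 forall_5)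
  qed (simp_all add: eq prod.p.vector_space_axioms atLeastAtMost_1_6 split_paired_Ex ex_vec_4 ex_vec_5)
qed

text \<open>
  The squares of \<open>e 4\<close> and \<open>e 5\<close> are linearly independent, which is the condition
  \<open>\<alpha> * \<delta> - \<beta> * \<gamma> \<noteq> 0\<close>; together with the nonzero components along both \<open>e 2 + e 3\<close> and \<open>e 6\<close> this
  decouples \<open>e 4\<close> and \<open>e 5\<close> from each other and from \<open>e 1\<close>, \<open>e 2\<close>, \<open>e 3\<close>.
\<close>

lemma derivations_N6_23:
  assumes "N6_23 smul mul \<alpha> \<beta> \<gamma> \<delta> e"
  shows "derivations smul mul =
    {d. Vector_Spaces.linear smul smul d \<and> (\<exists>d11 d61 d62 d64 d65.
      d (e 1) = d11 \<cdot> e 1 + d61 \<cdot> e 6 \<and>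
      d (e 2) = d11 \<cdot> e 2 + d11 \<cdot> e 3 + d62 \<cdot> e 6 \<and>
      d (e 3) = d11 \<cdot> e 2 + d11 \<cdot> e 3 - d62 \<cdot> e 6 \<and>
      d (e 4) = d11 \<cdot> e 4 + d64 \<cdot> e 6 \<and>
      d (e 5) = d11 \<cdot> e 5 + d65 \<cdot> e 6 \<and>
      d (e 6) = (2 * d11) \<cdot> e 6)}"
    (is "_ = {d. _ \<and> ?P d}")
    and "\<exists>\<phi> :: 'k \<times> ('k ^ 4) \<Rightarrow> 'v \<Rightarrow> 'v.
      vector_space_iso_onto (module_prod.scale (*) (*s)) (fun_scale smul) \<phi> (derivations smul mul)"
    (is ?iso)
proof -
  interpret plane_squares smul mul 6 e "f_coeff \<alpha> \<gamma>" "last_coeff \<beta> \<delta>"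
    using assms by (intro plane_squaresI[OF char alg]) (simp_all add: N6_23_def zero_scale)
  have nonzero: "\<alpha> \<noteq> 0" "\<beta> \<noteq> 0" "\<gamma> \<noteq> 0" "\<delta> \<noteq> 0"
    using assms by (simp_all add: N6_23_def)
  note [simp] = nonzero
  have nonsingular: "\<alpha> * \<delta> - \<beta> * \<gamma> \<noteq> 0"
    using assms by (simp add: N6_23_def)
  note coords = coord.add coord.diff coord.neg coord.scale coord_basis atLeastAtMost_1_6
  show eq: "derivations smul mul = {d. Vector_Spaces.linear smul smul d \<and> ?P d}"
  proof (rule derivations_eqI)
    fix d assume d: "Vector_Spaces.linear smul smul d"
    note iff = derivation_iff_scalar[OF d]
    show "d \<in> derivations smul mul \<longleftrightarrow> ?P d"
    proof
      assume "d \<in> derivations smul mul"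
      note system = this[unfolded iff atLeastAtMost_1_6 f_coeff_def last_coeff_def, simplified]
      have zero: "coord 4 (d (e 5)) = 0 \<and> coord 5 (d (e 4)) = 0"
        using system
        by (intro unique_zero_of_2_by_2[OF nonsingular]) (simp_all add: mult.commute)
      show "?P d"
        using system zero
        by - (rule exI[of _ "coord 1 (d (e 1))"],
          rule exI[of _ "coord 6 (d (e 1))"],
          rule exI[of _ "coord 6 (d (e 2))"],
          rule exI[of _ "coord 6 (d (e 4))"],
          rule exI[of _ "coord 6 (d (e 5))"],
          elim conjE, simp add: eq_iff_coord coords add_eq_0_iff2, (simp add: field_simps)?)
    next
      assume "?P d"
      then show "d \<in> derivations smul mul"
        unfolding iff
        by (elim exE conjE) (simp add: coords f_coeff_def last_coeff_def, (simp add: field_simps)?)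
    qed
  qed
  interpret prod: vector_space_prod "(*) :: 'k \<Rightarrow> 'k \<Rightarrow> 'k" "(*s) :: 'k \<Rightarrow> 'k ^ 4 \<Rightarrow> 'k ^ 4"
    by unfold_locales
  let ?C = "\<lambda>(u :: 'k, v :: 'k ^ 4). (\<lambda>_::nat. 0)(
      1 := u \<cdot> e 1 + v$1 \<cdot> e 6,
      2 := u \<cdot> e 2 + u \<cdot> e 3 + v$2 \<cdot> e 6,
      3 := u \<cdot> e 2 + u \<cdot> e 3 - v$2 \<cdot> e 6,
      4 := u \<cdot> e 4 + v$3 \<cdot> e 6,
      5 := u \<cdot> e 5 + v$4 \<cdot> e 6,
      6 := (2 * u) \<cdot> e 6)"
  show ?iso
  proof (rule iso_onto_linear_family[where C = ?C])
    fix j :: nat assume "j \<in> {1..6}"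
    then show "Vector_Spaces.linear prod.scale smul (\<lambda>x. ?C x j)"
      unfolding Vector_Spaces.linear_iff atLeastAtMost_1_6
      using prod.p.vector_space_axioms vector_space_axioms
      by (auto simp: prod.scale_def algebra_simps)
  next
    fix x :: "'k \<times> ('k ^ 4)"
    assume "\<forall>j\<in>{1..6}. ?C x j = 0"
    then show "x = 0"
      by (cases x) (simp add: eq_iff_coord coords zero_prod_def vec_eq_iff forall_4)
  qed (simp_all add: eq prod.p.vector_space_axioms atLeastAtMost_1_6 split_paired_Ex ex_vec_4)
qed

lemma derivations_N6_24:
  assumes "N6_24 smul mul \<alpha> \<beta> \<gamma> e"
  shows "derivations smul mul =
    {d. Vector_Spaces.linear smul smul d \<and> (\<exists>d11 d51 d61 d62 d64 d65.
      d (e 1) = d11 \<cdot> e 1 + d51 \<cdot> e 5 + d61 \<cdot> e 6 \<and>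
      d (e 2) = d11 \<cdot> e 2 + d11 \<cdot> e 3 + d62 \<cdot> e 6 \<and>
      d (e 3) = d11 \<cdot> e 2 + d11 \<cdot> e 3 - d62 \<cdot> e 6 \<and>
      d (e 4) = d11 \<cdot> e 4 + d64 \<cdot> e 6 \<and>
      d (e 5) = - (\<gamma> * d51) \<cdot> e 1 + d11 \<cdot> e 5 + d65 \<cdot> e 6 \<and>
      d (e 6) = (2 * d11) \<cdot> e 6)}"
    (is "_ = {d. _ \<and> ?P d}")
    and "\<exists>\<phi> :: ('k ^ 2) \<times> ('k ^ 4) \<Rightarrow> 'v \<Rightarrow> 'v.
      vector_space_iso_onto (module_prod.scale (*s) (*s)) (fun_scale smul) \<phi> (derivations smul mul)"
    (is ?iso)
proof -
  interpret plane_squares smul mul 6 e "f_coeff \<alpha> \<gamma>" "last_coeff \<beta> 0"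
    using assms by (intro plane_squaresI[OF char alg]) (simp_all add: N6_24_def zero_scale)
  have nonzero: "\<alpha> \<noteq> 0" "\<beta> \<noteq> 0" "\<gamma> \<noteq> 0"
    using assms by (simp_all add: N6_24_def)
  note [simp] = nonzero
  note coords = coord.add coord.diff coord.neg coord.scale coord_basis atLeastAtMost_1_6
  show eq: "derivations smul mul = {d. Vector_Spaces.linear smul smul d \<and> ?P d}"
  proof (rule derivations_eqI)
    fix d assume d: "Vector_Spaces.linear smul smul d"
    note iff = derivation_iff_scalar[OF d]
    show "d \<in> derivations smul mul \<longleftrightarrow> ?P d"
    proof
      assume "d \<in> derivations smul mul"
      note system = this[unfolded iff atLeastAtMost_1_6 f_coeff_def last_coeff_def, simplified]
      show "?P d"
        using system
        by - (rule exI[of _ "coord 1 (d (e 1))"],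
          rule exI[of _ "coord 5 (d (e 1))"],
          rule exI[of _ "coord 6 (d (e 1))"],
          rule exI[of _ "coord 6 (d (e 2))"],
          rule exI[of _ "coord 6 (d (e 4))"],
          rule exI[of _ "coord 6 (d (e 5))"],
          elim conjE, simp add: eq_iff_coord coords add_eq_0_iff2, (simp add: field_simps)?)
    next
      assume "?P d"
      then show "d \<in> derivations smul mul"
        unfolding iff
        by (elim exE conjE) (simp add: coords f_coeff_def last_coeff_def, (simp add: field_simps)?)
    qed
  qed
  interpret prod: vector_space_prod "(*s) :: 'k \<Rightarrow> 'k ^ 2 \<Rightarrow> 'k ^ 2" "(*s) :: 'k \<Rightarrow> 'k ^ 4 \<Rightarrow> 'k ^ 4"
    by unfold_locales
  let ?C = "\<lambda>(u :: 'k ^ 2, v :: 'k ^ 4). (\<lambda>_::nat. 0)(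
      1 := u$1 \<cdot> e 1 + u$2 \<cdot> e 5 + v$1 \<cdot> e 6,
      2 := u$1 \<cdot> e 2 + u$1 \<cdot> e 3 + v$2 \<cdot> e 6,
      3 := u$1 \<cdot> e 2 + u$1 \<cdot> e 3 - v$2 \<cdot> e 6,
      4 := u$1 \<cdot> e 4 + v$3 \<cdot> e 6,
      5 := - (\<gamma> * u$2) \<cdot> e 1 + u$1 \<cdot> e 5 + v$4 \<cdot> e 6,
      6 := (2 * u$1) \<cdot> e 6)"
  show ?iso
  proof (rule iso_onto_linear_family[where C = ?C])
    fix j :: nat assume "j \<in> {1..6}"
    then show "Vector_Spaces.linear prod.scale smul (\<lambda>x. ?C x j)"
      unfolding Vector_Spaces.linear_iff atLeastAtMost_1_6
      using prod.p.vector_space_axioms vector_space_axioms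
      by (auto simp: prod.scale_def algebra_simps)
  next
    fix x :: "('k ^ 2) \<times> ('k ^ 4)"
    assume "\<forall>j\<in>{1..6}. ?C x j = 0"
    then show "x = 0"
      by (cases x) (simp add: eq_iff_coord coords zero_prod_def vec_eq_iff forall_2 forall_4)
  qed (simp_all add: eq prod.p.vector_space_axioms atLeastAtMost_1_6 split_paired_Ex ex_vec_2 ex_vec_4)
qed

end

theorem mainTheorem10:
  fixes smul :: "'k::field \<Rightarrow> 'v::ab_group_add \<Rightarrow> 'v" (infixr \<open>\<cdot>\<close> 75)
    and mul :: "'v \<Rightarrow> 'v \<Rightarrow> 'v"
    and e :: "nat \<Rightarrow> 'v"
  assumes "CHAR('k) \<noteq> 2"
    and "evolution_algebra smul mul"
    and "indecomposable smul mul"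
    and "power_associative smul mul"
    and "nil_algebra mul"
    and "vector_space.dim smul (UNIV :: 'v set) \<le> 6"
    and "\<not> associative_on mul UNIV"
    and "vector_space.dim smul (annihilator mul) = 1"
  shows "(N4_6 smul mul e \<longrightarrow>
            derivations smul mul =
              {d. Vector_Spaces.linear smul smul d \<and> (\<exists>d11 d22 d41 d42.
                d (e 1) = d11 \<cdot> e 1 + d41 \<cdot> e 4 \<and>
                d (e 2) = d22 \<cdot> e 2 + (2 * d11 - d22) \<cdot> e 3 + d42 \<cdot> e 4 \<and>
                d (e 3) = (2 * d11 - d22) \<cdot> e 2 + d22 \<cdot> e 3 - d42 \<cdot> e 4 \<and>
                d (e 4) = (2 * d22) \<cdot> e 4)} \<and>
            (\<exists>\<phi> :: ('k ^ 2) \<times> ('k ^ 2) \<Rightarrow> 'v \<Rightarrow> 'v.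
               vector_space_iso_onto (module_prod.scale (*s) (*s)) (fun_scale smul) \<phi> (derivations smul mul))) \<and>
         (\<forall>\<alpha>. N5_10 smul mul \<alpha> e \<longrightarrow>
            derivations smul mul =
              {d. Vector_Spaces.linear smul smul d \<and> (\<exists>d11 d22 d51 d42 d52 d54.
                d (e 1) = d11 \<cdot> e 1 + d51 \<cdot> e 5 \<and>
                d (e 2) = d22 \<cdot> e 2 + (2 * d11 - d22) \<cdot> e 3 + d42 \<cdot> e 4 + d52 \<cdot> e 5 \<and>
                d (e 3) = (2 * d11 - d22) \<cdot> e 2 + d22 \<cdot> e 3 - d42 \<cdot> e 4 - d52 \<cdot> e 5 \<and>
                d (e 4) = - (\<alpha> * d42) \<cdot> e 2 - (\<alpha> * d42) \<cdot> e 3 + d22 \<cdot> e 4 + d54 \<cdot> e 5 \<and>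
                d (e 5) = (2 * d22) \<cdot> e 5)} \<and>
            (\<exists>\<phi> :: ('k ^ 3) \<times> ('k ^ 3) \<Rightarrow> 'v \<Rightarrow> 'v.
               vector_space_iso_onto (module_prod.scale (*s) (*s)) (fun_scale smul) \<phi> (derivations smul mul))) \<and>
         (\<forall>\<alpha>. N5_11 smul mul \<alpha> e \<longrightarrow>
            derivations smul mul =
              {d. Vector_Spaces.linear smul smul d \<and> (\<exists>d11 d22 d41 d51 d52 d54.
                d (e 1) = d11 \<cdot> e 1 + d41 \<cdot> e 4 + d51 \<cdot> e 5 \<and>
                d (e 2) = d22 \<cdot> e 2 + (2 * d11 - d22) \<cdot> e 3 + d52 \<cdot> e 5 \<and>
                d (e 3) = (2 * d11 - d22) \<cdot> e 2 + d22 \<cdot> e 3 - d52 \<cdot> e 5 \<and>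
                d (e 4) = - (\<alpha> * d41) \<cdot> e 1 + d11 \<cdot> e 4 + d54 \<cdot> e 5 \<and>
                d (e 5) = (2 * d22) \<cdot> e 5)} \<and>
            (\<exists>\<phi> :: ('k ^ 3) \<times> ('k ^ 3) \<Rightarrow> 'v \<Rightarrow> 'v.
               vector_space_iso_onto (module_prod.scale (*s) (*s)) (fun_scale smul) \<phi> (derivations smul mul))) \<and>
         (\<forall>\<alpha> \<beta>. N5_12 smul mul \<alpha> \<beta> e \<longrightarrow>
            derivations smul mul =
              {d. Vector_Spaces.linear smul smul d \<and> (\<exists>d11 d51 d52 d54.
                d (e 1) = d11 \<cdot> e 1 + d51 \<cdot> e 5 \<and>
                d (e 2) = d11 \<cdot> e 2 + d11 \<cdot> e 3 + d52 \<cdot> e 5 \<and>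
                d (e 3) = d11 \<cdot> e 2 + d11 \<cdot> e 3 - d52 \<cdot> e 5 \<and>
                d (e 4) = d11 \<cdot> e 4 + d54 \<cdot> e 5 \<and>
                d (e 5) = (2 * d11) \<cdot> e 5)} \<and>
            (\<exists>\<phi> :: 'k \<times> ('k ^ 3) \<Rightarrow> 'v \<Rightarrow> 'v.
               vector_space_iso_onto (module_prod.scale (*) (*s)) (fun_scale smul) \<phi> (derivations smul mul))) \<and>
         (\<forall>\<alpha> \<beta>. N6_19 smul mul \<alpha> \<beta> e \<longrightarrow>
            derivations smul mul =
              {d. Vector_Spaces.linear smul smul d \<and> (\<exists>d11 d22 d61 d42 d52 d62 d54 d64 d65.
                d (e 1) = d11 \<cdot> e 1 + d61 \<cdot> e 6 \<and>
                d (e 2) = d22 \<cdot> e 2 + (2 * d11 - d22) \<cdot> e 3 + d42 \<cdot> e 4 + d52 \<cdot> e 5 + d62 \<cdot> e 6 \<and>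
                d (e 3) = (2 * d11 - d22) \<cdot> e 2 + d22 \<cdot> e 3 - d42 \<cdot> e 4 - d52 \<cdot> e 5 - d62 \<cdot> e 6 \<and>
                d (e 4) = - (\<alpha> * d42) \<cdot> e 2 - (\<alpha> * d42) \<cdot> e 3 + d22 \<cdot> e 4 + d54 \<cdot> e 5 + d64 \<cdot> e 6 \<and>
                d (e 5) = - (\<beta> * d52) \<cdot> e 2 - (\<beta> * d52) \<cdot> e 3 - (inverse \<alpha> * \<beta> * d54) \<cdot> e 4 + d22 \<cdot> e 5 + d65 \<cdot> e 6 \<and>
                d (e 6) = (2 * d22) \<cdot> e 6)} \<and>
            (\<exists>\<phi> :: ('k ^ 5) \<times> ('k ^ 4) \<Rightarrow> 'v \<Rightarrow> 'v.
               vector_space_iso_onto (module_prod.scale (*s) (*s)) (fun_scale smul) \<phi> (derivations smul mul))) \<and>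
         (\<forall>\<alpha> \<beta>. N6_20 smul mul \<alpha> \<beta> e \<longrightarrow>
            derivations smul mul =
              {d. Vector_Spaces.linear smul smul d \<and> (\<exists>d11 d22 d41 d61 d52 d62 d64 d65.
                d (e 1) = d11 \<cdot> e 1 + d41 \<cdot> e 4 + d61 \<cdot> e 6 \<and>
                d (e 2) = d22 \<cdot> e 2 + (2 * d11 - d22) \<cdot> e 3 + d52 \<cdot> e 5 + d62 \<cdot> e 6 \<and>
                d (e 3) = (2 * d11 - d22) \<cdot> e 2 + d22 \<cdot> e 3 - d52 \<cdot> e 5 - d62 \<cdot> e 6 \<and>
                d (e 4) = - (\<alpha> * d41) \<cdot> e 1 + d11 \<cdot> e 4 + d64 \<cdot> e 6 \<and>
                d (e 5) = - (\<beta> * d52) \<cdot> e 2 - (\<beta> * d52) \<cdot> e 3 + d22 \<cdot> e 5 + d65 \<cdot> e 6 \<and>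
                d (e 6) = (2 * d22) \<cdot> e 6)} \<and>
            (\<exists>\<phi> :: ('k ^ 4) \<times> ('k ^ 4) \<Rightarrow> 'v \<Rightarrow> 'v.
               vector_space_iso_onto (module_prod.scale (*s) (*s)) (fun_scale smul) \<phi> (derivations smul mul))) \<and>
         (\<forall>\<alpha> \<beta> \<gamma>. N6_21 smul mul \<alpha> \<beta> \<gamma> e \<longrightarrow>
            derivations smul mul =
              {d. Vector_Spaces.linear smul smul d \<and> (\<exists>d11 d61 d52 d62 d64 d65.
                d (e 1) = d11 \<cdot> e 1 + d61 \<cdot> e 6 \<and>
                d (e 2) = d11 \<cdot> e 2 + d11 \<cdot> e 3 + d52 \<cdot> e 5 + d62 \<cdot> e 6 \<and>
                d (e 3) = d11 \<cdot> e 2 + d11 \<cdot> e 3 - d52 \<cdot> e 5 - d62 \<cdot> e 6 \<and>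
                d (e 4) = d11 \<cdot> e 4 + d64 \<cdot> e 6 \<and>
                d (e 5) = - (\<gamma> * d52) \<cdot> e 2 - (\<gamma> * d52) \<cdot> e 3 + d11 \<cdot> e 5 + d65 \<cdot> e 6 \<and>
                d (e 6) = (2 * d11) \<cdot> e 6)} \<and>
            (\<exists>\<phi> :: ('k ^ 2) \<times> ('k ^ 4) \<Rightarrow> 'v \<Rightarrow> 'v.
               vector_space_iso_onto (module_prod.scale (*s) (*s)) (fun_scale smul) \<phi> (derivations smul mul))) \<and>
         (\<forall>\<alpha> \<beta>. N6_22 smul mul \<alpha> \<beta> e \<longrightarrow>
            derivations smul mul =
              {d. Vector_Spaces.linear smul smul d \<and> (\<exists>d11 d22 d41 d51 d61 d62 d54 d64 d65.
                d (e 1) = d11 \<cdot> e 1 + d41 \<cdot> e 4 + d51 \<cdot> e 5 + d61 \<cdot> e 6 \<and>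
                d (e 2) = d22 \<cdot> e 2 + (2 * d11 - d22) \<cdot> e 3 + d62 \<cdot> e 6 \<and>
                d (e 3) = (2 * d11 - d22) \<cdot> e 2 + d22 \<cdot> e 3 - d62 \<cdot> e 6 \<and>
                d (e 4) = - (\<alpha> * d41) \<cdot> e 1 + d11 \<cdot> e 4 + d54 \<cdot> e 5 + d64 \<cdot> e 6 \<and>
                d (e 5) = - (\<beta> * d51) \<cdot> e 1 - (inverse \<alpha> * \<beta> * d54) \<cdot> e 4 + d11 \<cdot> e 5 + d65 \<cdot> e 6 \<and>
                d (e 6) = (2 * d22) \<cdot> e 6)} \<and>
            (\<exists>\<phi> :: ('k ^ 5) \<times> ('k ^ 4) \<Rightarrow> 'v \<Rightarrow> 'v.
               vector_space_iso_onto (module_prod.scale (*s) (*s)) (fun_scale smul) \<phi> (derivations smul mul))) \<and>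
         (\<forall>\<alpha> \<beta> \<gamma> \<delta>. N6_23 smul mul \<alpha> \<beta> \<gamma> \<delta> e \<longrightarrow>
            derivations smul mul =
              {d. Vector_Spaces.linear smul smul d \<and> (\<exists>d11 d61 d62 d64 d65.
                d (e 1) = d11 \<cdot> e 1 + d61 \<cdot> e 6 \<and>
                d (e 2) = d11 \<cdot> e 2 + d11 \<cdot> e 3 + d62 \<cdot> e 6 \<and>
                d (e 3) = d11 \<cdot> e 2 + d11 \<cdot> e 3 - d62 \<cdot> e 6 \<and>
                d (e 4) = d11 \<cdot> e 4 + d64 \<cdot> e 6 \<and>
                d (e 5) = d11 \<cdot> e 5 + d65 \<cdot> e 6 \<and>
                d (e 6) = (2 * d11) \<cdot> e 6)} \<and>
            (\<exists>\<phi> :: 'k \<times> ('k ^ 4) \<Rightarrow> 'v \<Rightarrow> 'v.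
               vector_space_iso_onto (module_prod.scale (*) (*s)) (fun_scale smul) \<phi> (derivations smul mul))) \<and>
         (\<forall>\<alpha> \<beta> \<gamma>. N6_24 smul mul \<alpha> \<beta> \<gamma> e \<longrightarrow>
            derivations smul mul =
              {d. Vector_Spaces.linear smul smul d \<and> (\<exists>d11 d51 d61 d62 d64 d65.
                d (e 1) = d11 \<cdot> e 1 + d51 \<cdot> e 5 + d61 \<cdot> e 6 \<and>
                d (e 2) = d11 \<cdot> e 2 + d11 \<cdot> e 3 + d62 \<cdot> e 6 \<and>
                d (e 3) = d11 \<cdot> e 2 + d11 \<cdot> e 3 - d62 \<cdot> e 6 \<and>
                d (e 4) = d11 \<cdot> e 4 + d64 \<cdot> e 6 \<and>
                d (e 5) = - (\<gamma> * d51) \<cdot> e 1 + d11 \<cdot> e 5 + d65 \<cdot> e 6 \<and>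
                d (e 6) = (2 * d11) \<cdot> e 6)} \<and>
            (\<exists>\<phi> :: ('k ^ 2) \<times> ('k ^ 4) \<Rightarrow> 'v \<Rightarrow> 'v.
               vector_space_iso_onto (module_prod.scale (*s) (*s)) (fun_scale smul) \<phi> (derivations smul mul)))"
proof -
  have alg: "nonassoc_algebra smul mul"
    using assms(2) by (simp only: evolution_algebra_def)
  note cases = derivations_N4_6[OF assms(1) alg]
    derivations_N5_10[OF assms(1) alg]
    derivations_N5_11[OF assms(1) alg]
    derivations_N5_12[OF assms(1) alg]
    derivations_N6_19[OF assms(1) alg]
    derivations_N6_20[OF assms(1) alg]
    derivations_N6_21[OF assms(1) alg]
    derivations_N6_22[OF assms(1) alg]
    derivations_N6_23[OF assms(1) alg]
    derivations_N6_24[OF assms(1) alg]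
  show ?thesis
    by (intro conjI allI impI) (erule cases)+
qed

end
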